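(* A graph $G=(V,E)$ is chordal if and only if the polyhedron $\mathcal{P}(G)$ is binary.
   Context: All graphs are finite and simple. A graph is chordal if it has no induced cycle of length at least 4. A clique is a set of pairwise adjacent vertices (the empty set is allowed). $N(w)$ is the set of neighbors of $w$. For $U\subseteq V$, $C(U)$ is the set of vertices not in $U$ adjacent to every vertex of $U$. For $w\in V$ and $U\subseteq V$, $\delta(w,U)$ is the set of edges joining $w$ to a vertex of $U$, and $y(F)=\sum_{e\in F}y_e$ for $F\subseteq E$. $\mathcal{C}_P(G)$ is the cone of all $(x,y)\in\mathbb{R}^V\times\mathbb{R}^E$ satisfying $$y\bigl(\delta(w,C(K\cup\{w\}))\bigr)+2\,y\bigl(\delta(w,K)\bigr)\le 2x_w\quad\forall w\in V,\ \text{cliques }K\subseteq N(w);$$ $$x_w\ge 0\quad\forall w\in V;\qquad y_e\ge 0\quad\forall e\in E.$$ $\mathcal{P}(G)$ is the intersection of $\mathcal{C}_P(G)$ with the hyperplane $\{(x,y):\sum_{v\in V}x_v-\sum_{e\in E}y_e=1\}$. A polyhedron is called binary if it is a polytope (i.e. it is bounded) and all its extreme points have all coordinates in $\{0,1\}$. *)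

theory Defs
  imports "HOL-Analysis.Analysis"
begin

text \<open>
  A graph is given by its vertex set and its edge set; an edge is the two-element set of its ends.
\<close>

definition fin_simple_graph :: "'v set \<Rightarrow> 'v set set \<Rightarrow> bool" where
  "fin_simple_graph V E \<longleftrightarrow> finite V \<and> (\<forall>e\<in>E. e \<subseteq> V \<and> card e = 2)"

definition nbrs :: "'v set set \<Rightarrow> 'v \<Rightarrow> 'v set" where
  "nbrs E w = {u. {w, u} \<in> E}"

definition clique :: "'v set \<Rightarrow> 'v set set \<Rightarrow> 'v set \<Rightarrow> bool" where
  "clique V E K \<longleftrightarrow> K \<subseteq> V \<and> (\<forall>u\<in>K. \<forall>v\<in>K. u \<noteq> v \<longrightarrow> {u, v} \<in> E)"

definition common_nbrs :: "'v set \<Rightarrow> 'v set set \<Rightarrow> 'v set \<Rightarrow> 'v set" where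
  "common_nbrs V E U = {v \<in> V. v \<notin> U \<and> (\<forall>u\<in>U. {v, u} \<in> E)}"

definition edges_between :: "'v set set \<Rightarrow> 'v \<Rightarrow> 'v set \<Rightarrow> 'v set set" where
  "edges_between E w U = {e \<in> E. \<exists>u\<in>U. e = {w, u}}"

text \<open>
  The list \<open>c\<close> enumerates the vertices of an induced cycle in cyclic order: two of them are
  adjacent in the graph exactly if they are cyclically consecutive.
\<close>

definition induced_cycle :: "'v set \<Rightarrow> 'v set set \<Rightarrow> 'v list \<Rightarrow> bool" where
  "induced_cycle V E c \<longleftrightarrow>
     length c \<ge> 3 \<and> distinct c \<and> set c \<subseteq> V \<and>
     (\<forall>i < length c. \<forall>j < length c.
        {c ! i, c ! j} \<in> E \<longleftrightarrow> j = Suc i mod length c \<or> i = Suc j mod length c)"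

definition chordal :: "'v set \<Rightarrow> 'v set set \<Rightarrow> bool" where
  "chordal V E \<longleftrightarrow> \<not> (\<exists>c. induced_cycle V E c \<and> length c \<ge> 4)"

text \<open>
  For \<open>V :: 'v set\<close> over a finite type \<open>'v\<close>, the space of vectors indexed by \<open>V\<close> and \<open>E\<close> is
  the coordinate subspace of \<open>(real^'v) \<times> (real^'v set)\<close> on which all coordinates outside
  \<open>V\<close> and outside \<open>E\<close> vanish.
\<close>

definition graph_space ::
    "'v::finite set \<Rightarrow> 'v set set \<Rightarrow> ((real^'v) \<times> (real^'v set)) set" where
  "graph_space V E = {(x, y). (\<forall>v. v \<notin> V \<longrightarrow> x $ v = 0) \<and> (\<forall>e. e \<notin> E \<longrightarrow> y $ e = 0)}"

definition cone_P ::
    "'v::finite set \<Rightarrow> 'v set set \<Rightarrow> ((real^'v) \<times> (real^'v set)) set" where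
  "cone_P V E = {(x, y) \<in> graph_space V E.
     (\<forall>w\<in>V. \<forall>K. clique V E K \<and> K \<subseteq> nbrs E w \<longrightarrow>
        (\<Sum>e\<in>edges_between E w (common_nbrs V E (K \<union> {w})). y $ e)
          + 2 * (\<Sum>e\<in>edges_between E w K. y $ e) \<le> 2 * x $ w) \<and>
     (\<forall>w\<in>V. x $ w \<ge> 0) \<and> (\<forall>e\<in>E. y $ e \<ge> 0)}"

definition polyhedron_P ::
    "'v::finite set \<Rightarrow> 'v set set \<Rightarrow> ((real^'v) \<times> (real^'v set)) set" where
  "polyhedron_P V E = cone_P V E \<inter> {(x, y). (\<Sum>v\<in>V. x $ v) - (\<Sum>e\<in>E. y $ e) = 1}"

text \<open>
  The coordinates forced to vanish by the embedding are harmless here, as their value is 0.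
\<close>

definition binary_polyhedron :: "((real^'i) \<times> (real^'j)) set \<Rightarrow> bool" where
  "binary_polyhedron S \<longleftrightarrow> polytope S \<and>
     (\<forall>x y. (x, y) extreme_point_of S \<longrightarrow> (\<forall>i. x $ i \<in> {0, 1}) \<and> (\<forall>j. y $ j \<in> {0, 1}))"

end

theory Submission
  imports Defs
begin

text \<open>
  The clique inequalities at \<open>w\<close> are the half-integral dual solutions of a fractional matching
  problem on the neighbours of \<open>w\<close>, where two neighbours may be matched if they are not
  adjacent and \<open>u\<close> has capacity \<open>y {w, u}\<close>. By duality they hold iff the weights on the edges at \<open>w\<close>
  can be paired off at \<open>w\<close>, within non-adjacent pairs, so that at most \<open>x w\<close> path mass runs through
  \<open>w\<close>. A point of the cone is thus a superposition of walks whose consecutive triples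
  induce a path. In a chordal graph such a walk is an induced path, so that the longest ones can be
  subtracted one after the other: the cone is generated by the incidence vectors of induced
  paths, which lie on the hyperplane, and the polyhedron is their convex hull. An induced cycle of
  length at least 4, on the other hand, has as many edges as vertices and yields a direction in
  which the polyhedron is unbounded.
\<close>

section \<open>Fractional matchings\<close>

text \<open>The indicator matrix of an unordered pair. A sum of two indicators, rather than the
  indicator of a disjunction, has these row sums without assuming
  \<open>u \<noteq> v\<close>.\<close>

definition pair_ind :: "'a \<Rightarrow> 'a \<Rightarrow> 'a \<Rightarrow> 'a \<Rightarrow> real" where
  "pair_ind u v i j = of_bool (i = u \<and> j = v) + of_bool (i = v \<and> j = u)"

lemma sum_of_bool_eq_conj:
  fixes c :: "'a::finite"
  shows "(\<Sum>j\<in>UNIV. of_bool (P \<and> j = c) :: real) = of_bool P"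
    and "(\<Sum>j\<in>UNIV. of_bool (j = c) :: real) = 1"
  by (auto simp: of_bool_def)

lemma sum_scaled_pair_ind:
  fixes u v :: "'a::finite"
  shows "(\<Sum>j\<in>UNIV. r * pair_ind u v i j) = r * of_bool (i = u) + r * of_bool (i = v)"
    and "(\<Sum>i\<in>UNIV. \<Sum>j\<in>UNIV. r * pair_ind u v i j) = 2 * r"
proof -
  show *: "(\<Sum>j\<in>UNIV. r * pair_ind u v i j) = r * of_bool (i = u) + r * of_bool (i = v)" for i
    by (simp add: pair_ind_def distrib_left sum.distrib sum_of_bool_eq_conj
        flip: sum_distrib_left)
  have "(\<Sum>i\<in>UNIV. \<Sum>j\<in>UNIV. r * pair_ind u v i j)
      = r * (\<Sum>i\<in>UNIV. of_bool (i = u)) + r * (\<Sum>i\<in>UNIV. of_bool (i = v))"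
    by (simp only: * sum.distrib sum_distrib_left)
  then show "(\<Sum>i\<in>UNIV. \<Sum>j\<in>UNIV. r * pair_ind u v i j) = 2 * r"
    by (simp add: sum_of_bool_eq_conj)
qed

lemma pair_ind_nonneg: "0 \<le> pair_ind u v i j"
  by (simp add: pair_ind_def)

lemma pair_ind_sym: "pair_ind u v i j = pair_ind u v j i"
  unfolding pair_ind_def by (subst add.commute) (simp only: conj_commute)

lemma pair_ind_eq_0:
  assumes "\<And>u v. R u v \<Longrightarrow> R v u" "R u v" "\<not> R i j"
  shows "pair_ind u v i j = 0"
proof -
  have "\<not> (i = u \<and> j = v)" "\<not> (i = v \<and> j = u)" using assms by blast+
  then show ?thesis by (simp only: pair_ind_def) simp
qed

text \<open>A matching is kept as a symmetric matrix. Each pair is stored in both orders, so the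
  total of all entries is twice the weight of the matching.\<close>

definition fractional_matching :: "('a::finite \<Rightarrow> 'a \<Rightarrow> bool) \<Rightarrow> ('a \<Rightarrow> real) \<Rightarrow> ('a \<Rightarrow> 'a \<Rightarrow> real) \<Rightarrow> bool"
  where "fractional_matching R b z \<longleftrightarrow>
    (\<forall>u v. 0 \<le> z u v) \<and> (\<forall>u v. z u v = z v u) \<and> (\<forall>u v. \<not> R u v \<longrightarrow> z u v = 0) \<and>
    (\<forall>u. (\<Sum>v\<in>UNIV. z u v) \<le> b u)"

text \<open>Compactness: as vectors in \<open>real^'a^'a\<close> the matchings form a closed set
  that contains 0. It is bounded because entries are nonnegative with row sums at most
  \<open>b\<close>.\<close>

lemma ex_maximum_fractional_matching:
  fixes b :: "'a::finite \<Rightarrow> real"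
  assumes "\<And>u. 0 \<le> b u"
  shows "\<exists>z. fractional_matching R b z \<and>
    (\<forall>z'. fractional_matching R b z' \<longrightarrow>
      (\<Sum>u\<in>UNIV. \<Sum>v\<in>UNIV. z' u v) \<le> (\<Sum>u\<in>UNIV. \<Sum>v\<in>UNIV. z u v))"
proof -
  define F where "F = {z :: real^'a^'a. fractional_matching R b (\<lambda>u v. z $ u $ v)}"
  have entry: "continuous_on UNIV (\<lambda>z :: real^'a^'a. z $ u $ v)" for u v
    by (intro continuous_intros)
  have row: "continuous_on UNIV (\<lambda>z :: real^'a^'a. \<Sum>v\<in>UNIV. z $ u $ v)" for u
    by (intro continuous_on_sum entry)
  have "closed {z :: real^'a^'a. \<not> R u v \<longrightarrow> z $ u $ v = 0}" for u v
    by (cases "R u v") (simp_all add: closed_Collect_eq entry)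
  then have "closed F"
    unfolding F_def fractional_matching_def
    by (intro closed_Collect_conj closed_Collect_all) (simp_all add: closed_Collect_le closed_Collect_eq entry row)
  moreover have "bounded F"
  proof -
    have "norm z \<le> (\<Sum>u\<in>UNIV. b u)" if "z \<in> F" for z
    proof -
      have "norm z \<le> (\<Sum>u\<in>UNIV. norm (z $ u))"
        by (simp add: norm_vec_def L2_set_le_sum)
      also have "\<dots> \<le> (\<Sum>u\<in>UNIV. \<Sum>v\<in>UNIV. \<bar>z $ u $ v\<bar>)"
        by (intro sum_mono norm_le_l1_cart)
      also have "\<dots> \<le> (\<Sum>u\<in>UNIV. b u)"
        using that by (intro sum_mono) (simp add: F_def fractional_matching_def)
      finally show ?thesis .
    qed
    then show ?thesis unfolding bounded_iff by blast
  qed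
  ultimately have "compact F" by (simp add: compact_eq_bounded_closed)
  moreover have "0 \<in> F" using assms by (simp add: F_def fractional_matching_def)
  moreover have "continuous_on F (\<lambda>z. \<Sum>u\<in>UNIV. \<Sum>v\<in>UNIV. z $ u $ v)"
    by (intro continuous_on_sum continuous_on_subset[OF entry]) simp
  ultimately have "\<exists>m\<in>F. \<forall>z\<in>F.
      (\<Sum>u\<in>UNIV. \<Sum>v\<in>UNIV. z $ u $ v) \<le> (\<Sum>u\<in>UNIV. \<Sum>v\<in>UNIV. m $ u $ v)"
    by (intro continuous_attains_sup) auto
  then obtain m where m: "m \<in> F" and max: "\<forall>z\<in>F.
      (\<Sum>u\<in>UNIV. \<Sum>v\<in>UNIV. z $ u $ v) \<le> (\<Sum>u\<in>UNIV. \<Sum>v\<in>UNIV. m $ u $ v)"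
    by blast
  have "(\<Sum>u\<in>UNIV. \<Sum>v\<in>UNIV. z u v) \<le> (\<Sum>u\<in>UNIV. \<Sum>v\<in>UNIV. m $ u $ v)"
    if "fractional_matching R b z" for z
  proof -
    have "(\<chi> u v. z u v) \<in> F" using that by (simp add: F_def vec_lambda_inverse)
    from bspec[OF max this] show ?thesis by simp
  qed
  moreover have "fractional_matching R b (\<lambda>u v. m $ u $ v)" using m by (simp add: F_def)
  ultimately show ?thesis by blast
qed

text \<open>
  Max-min duality for fractional \<open>b\<close>-matchings with a half-integral dual, given by the stable set \<open>A\<close>
  and its neighbours. \<open>A\<close> consists of the slack vertices of a maximum matching, chosen with as
  many slack vertices as possible; this choice replaces the search for augmenting paths.
\<close>

lemma fractional_matching_duality:
  fixes b :: "'a::finite \<Rightarrow> real"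
  assumes b: "\<And>u. 0 \<le> b u" and sym: "\<And>u v. R u v \<Longrightarrow> R v u" and irr: "\<And>u. \<not> R u u"
  obtains z A where "fractional_matching R b z" "\<And>u v. u \<in> A \<Longrightarrow> v \<in> A \<Longrightarrow> \<not> R u v"
    "(\<Sum>u\<in>UNIV. \<Sum>v\<in>UNIV. z u v) = (\<Sum>u\<in>-A. b u) + (\<Sum>v | \<exists>u\<in>A. R u v. b v)"
proof -
  define total where "total z = (\<Sum>u\<in>UNIV. \<Sum>v\<in>UNIV. z u v)" for z :: "'a \<Rightarrow> 'a \<Rightarrow> real"
  define slack where "slack z = {u. (\<Sum>v\<in>UNIV. z u v) < b u}" for z :: "'a \<Rightarrow> 'a \<Rightarrow> real"
  define opt where "opt z \<longleftrightarrow> fractional_matching R b z \<and>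
    (\<forall>z'. fractional_matching R b z' \<longrightarrow> total z' \<le> total z)" for z
  obtain z0 where "opt z0"
    using ex_maximum_fractional_matching[of b R] b unfolding opt_def total_def by blast
  moreover have "\<forall>z. opt z \<longrightarrow> card (slack z) < Suc (card (UNIV :: 'a set))"
    by (simp add: card_mono less_Suc_eq_le)
  ultimately obtain z where z: "opt z" and zmax: "\<And>z'. opt z' \<Longrightarrow> card (slack z') \<le> card (slack z)"
    using Lattices_Big.ex_has_greatest_nat[of opt z0 "\<lambda>z. card (slack z)"] by blast
  have fm: "fractional_matching R b z" using z by (simp add: opt_def)
  then have nn: "\<And>u v. 0 \<le> z u v" and zs: "\<And>u v. z u v = z v u"
    and supp: "\<And>u v. \<not> R u v \<Longrightarrow> z u v = 0" and row: "\<And>u. (\<Sum>v\<in>UNIV. z u v) \<le> b u"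
    unfolding fractional_matching_def by blast+
  define A where "A = slack z"
  \<comment> \<open>Two slack vertices related by \<open>R\<close> could still be matched with each
    other, which would increase the maximum.\<close>
  have indep: "\<not> R u v" if uv: "u \<in> A" "v \<in> A" for u v
  proof
    assume R: "R u v"
    then have ne: "u \<noteq> v" using irr by blast
    define r where "r = min (b u - (\<Sum>t\<in>UNIV. z u t)) (b v - (\<Sum>t\<in>UNIV. z v t))"
    have r: "r > 0" using uv by (simp add: r_def A_def slack_def)
    define z' where "z' i j = z i j + r * pair_ind u v i j" for i j
    have rows: "(\<Sum>j\<in>UNIV. z' i j) = (\<Sum>j\<in>UNIV. z i j) + r * of_bool (i = u) + r * of_bool (i = v)" for i
      by (simp add: z'_def sum.distrib sum_scaled_pair_ind)
    have "fractional_matching R b z'"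
      unfolding fractional_matching_def
    proof (intro conjI allI impI)
      show "0 \<le> z' i j" for i j using nn[of i j] r by (simp add: z'_def pair_ind_nonneg)
      show "z' i j = z' j i" for i j
        unfolding z'_def using zs[of i j] pair_ind_sym by metis
      show "z' i j = 0" if "\<not> R i j" for i j
        using supp[OF that] pair_ind_eq_0[of R, OF sym R that] by (simp add: z'_def)
      show "(\<Sum>j\<in>UNIV. z' i j) \<le> b i" for i
        using row[of i] ne by (auto simp: rows r_def)
    qed
    moreover have "total z' = total z + 2 * r"
      by (simp add: total_def z'_def sum.distrib sum_scaled_pair_ind)
    ultimately show False using z r unfolding opt_def by force
  qed
  \<comment> \<open>Moving weight from \<open>{v, t}\<close> to \<open>{u, v}\<close> would make \<open>t\<close> a further slack vertex.\<close>
  have absorb: "t \<in> A" if u: "u \<in> A" and R: "R u v" and vt: "z v t \<noteq> 0" for u v t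
  proof (rule ccontr)
    assume t: "t \<notin> A"
    have Rvt: "R v t" using supp vt by blast
    have ne: "u \<noteq> v" "v \<noteq> t" "t \<noteq> u" using R Rvt irr u t by blast+
    \<comment> \<open>Half the slack keeps \<open>u\<close> slack after its row grows by
      \<open>r\<close>; the bound \<open>z v t\<close> keeps the reduced entry nonnegative.\<close>
    define r where "r = min ((b u - (\<Sum>t\<in>UNIV. z u t)) / 2) (z v t)"
    have r: "r > 0" using u vt nn[of v t] by (simp add: r_def A_def slack_def)
    have r2: "r < b u - (\<Sum>t\<in>UNIV. z u t)" using u by (simp add: r_def A_def slack_def min_def)
    have r3: "r \<le> z v t" "r \<le> z t v" using zs[of v t] by (simp_all add: r_def)
    define z' where "z' i j = z i j + r * pair_ind u v i j - r * pair_ind v t i j" for i j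
    have rows: "(\<Sum>j\<in>UNIV. z' i j) = (\<Sum>j\<in>UNIV. z i j) + r * of_bool (i = u) - r * of_bool (i = t)" for i
      by (simp add: z'_def sum.distrib sum_subtractf sum_scaled_pair_ind)
    have "fractional_matching R b z'"
      unfolding fractional_matching_def
    proof (intro conjI allI impI)
      show "0 \<le> z' i j" for i j using nn[of i j] r r3 ne by (auto simp: z'_def pair_ind_def)
      show "z' i j = z' j i" for i j
        unfolding z'_def using zs[of i j] pair_ind_sym by metis
      show "z' i j = 0" if "\<not> R i j" for i j
        using supp[OF that] pair_ind_eq_0[of R, OF sym R that] pair_ind_eq_0[of R, OF sym Rvt that]
        by (simp add: z'_def)
      show "(\<Sum>j\<in>UNIV. z' i j) \<le> b i" for i
        using row[of i] ne r r2 by (auto simp: rows)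
    qed
    moreover have "total z' = total z"
      by (simp add: total_def z'_def sum.distrib sum_subtractf sum_scaled_pair_ind)
    ultimately have "opt z'" using z by (simp add: opt_def)
    moreover have "insert t A \<subseteq> slack z'"
      using t ne r r2 row[of t] by (auto simp: A_def slack_def rows)
    then have "card (insert t A) \<le> card (slack z')" by (intro card_mono) auto
    ultimately show False using zmax[of z'] t by (simp add: A_def)
  qed
  have tight: "(\<Sum>t\<in>UNIV. z v t) = b v" if "v \<notin> A" for v
    using that row[of v] by (simp add: A_def slack_def)
  \<comment> \<open>Rows of \<open>A\<close> have entries only in columns of \<open>?B\<close>.
    Conversely, rows of \<open>?B\<close> are supported on \<open>A\<close> by
    \<open>absorb\<close>, and they are tight since \<open>?B\<close> is disjoint from
    \<open>A\<close>.\<close>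
  let ?B = "{v. \<exists>u\<in>A. R u v}"
  have "(\<Sum>u\<in>A. \<Sum>v\<in>UNIV. z u v) = (\<Sum>v\<in>UNIV. \<Sum>u\<in>A. z v u)"
    using sum.swap[of z UNIV A] zs by simp
  also have "\<dots> = (\<Sum>v\<in>?B. \<Sum>u\<in>A. z v u)"
  proof (rule sum.mono_neutral_right)
    have "z v u = 0" if "v \<notin> ?B" "u \<in> A" for u v
      using that supp[of v u] sym by blast
    then show "\<forall>v\<in>UNIV - ?B. (\<Sum>u\<in>A. z v u) = 0" by (simp add: sum.neutral)
  qed auto
  also have "\<dots> = (\<Sum>v\<in>?B. \<Sum>u\<in>UNIV. z v u)"
  proof (rule sum.cong[OF refl])
    fix v assume "v \<in> ?B"
    then have "\<forall>t\<in>UNIV - A. z v t = 0" using absorb by blast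
    then show "(\<Sum>u\<in>A. z v u) = (\<Sum>u\<in>UNIV. z v u)"
      by (intro sum.mono_neutral_left) auto
  qed
  also have "\<dots> = (\<Sum>v\<in>?B. b v)"
    using indep tight by (intro sum.cong[OF refl]) blast
  finally have "(\<Sum>u\<in>A. \<Sum>v\<in>UNIV. z u v) = (\<Sum>v\<in>?B. b v)" .
  moreover have "(\<Sum>u\<in>UNIV. \<Sum>v\<in>UNIV. z u v) =
      (\<Sum>u\<in>A. \<Sum>v\<in>UNIV. z u v) + (\<Sum>u\<in>-A. \<Sum>v\<in>UNIV. z u v)"
    using sum.Int_Diff[of UNIV "\<lambda>u. \<Sum>v\<in>UNIV. z u v" A] by (simp add: Compl_eq_Diff_UNIV)
  moreover have "(\<Sum>u\<in>-A. \<Sum>v\<in>UNIV. z u v) = (\<Sum>u\<in>-A. b u)"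
    by (intro sum.cong tight) auto
  ultimately have "(\<Sum>u\<in>UNIV. \<Sum>v\<in>UNIV. z u v) = (\<Sum>u\<in>-A. b u) + (\<Sum>v\<in>?B. b v)"
    by linarith
  then show thesis using that fm indep by blast
qed

section \<open>The cone in terms of transitions\<close>

text \<open>In a simple graph: \<open>u\<close>, \<open>w\<close>, \<open>v\<close> is an induced
  path. For fixed \<open>w\<close> this is the complement graph on the neighbours of
  \<open>w\<close>, so its stable sets there are the cliques.\<close>

definition turn :: "'v set set \<Rightarrow> 'v \<Rightarrow> 'v \<Rightarrow> 'v \<Rightarrow> bool" where
  "turn E w u v \<longleftrightarrow> {w, u} \<in> E \<and> {w, v} \<in> E \<and> u \<noteq> v \<and> {u, v} \<notin> E"

lemma turn_sym: "turn E w u v \<Longrightarrow> turn E w v u"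
  by (auto simp: turn_def insert_commute)

text \<open>
  \<open>z w u v\<close> is the amount of path mass that passes through \<open>w\<close> coming from \<open>u\<close> and leaving to \<open>v\<close>
  (counted in both orders). The last condition says that the paths through \<open>w\<close> have total mass at
  most \<open>x w\<close>: the mass on the edges at \<open>w\<close> counts every path that has \<open>w\<close> in its interior twice.
\<close>

definition transitions ::
    "'v::finite set \<Rightarrow> 'v set set \<Rightarrow> ('v \<Rightarrow> real) \<Rightarrow> ('v set \<Rightarrow> real) \<Rightarrow> ('v \<Rightarrow> 'v \<Rightarrow> 'v \<Rightarrow> real) \<Rightarrow> bool"
  where "transitions V E x y z \<longleftrightarrow>
    (\<forall>v. v \<notin> V \<longrightarrow> x v = 0) \<and> (\<forall>e. 0 \<le> y e) \<and> (\<forall>e. e \<notin> E \<longrightarrow> y e = 0) \<and>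
    (\<forall>w. fractional_matching (turn E w) (\<lambda>u. y {w, u}) (z w)) \<and>
    (\<forall>w. (\<Sum>u\<in>UNIV. y {w, u}) \<le> x w + (\<Sum>u\<in>UNIV. \<Sum>v\<in>UNIV. z w u v) / 2)"

section \<open>Clique inequalities as dual bounds\<close>

lemma edge_distinct: "fin_simple_graph V E \<Longrightarrow> {u, v} \<in> E \<Longrightarrow> u \<noteq> v"
  by (force simp: fin_simple_graph_def)

lemma edge_subset: "fin_simple_graph V E \<Longrightarrow> {u, v} \<in> E \<Longrightarrow> u \<in> V \<and> v \<in> V"
  by (force simp: fin_simple_graph_def)

lemma sum_edges_between:
  fixes y :: "'v::finite set \<Rightarrow> real"
  assumes "\<And>e. e \<notin> E \<Longrightarrow> y e = 0"
  shows "(\<Sum>e\<in>edges_between E w U. y e) = (\<Sum>u\<in>U. y {w, u})"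
proof -
  have "edges_between E w U = (\<lambda>u. {w, u}) ` {u \<in> U. {w, u} \<in> E}"
    by (auto simp: edges_between_def)
  moreover have "inj_on (\<lambda>u. {w, u}) {u \<in> U. {w, u} \<in> E}"
    by (auto simp: inj_on_def doubleton_eq_iff)
  ultimately have "(\<Sum>e\<in>edges_between E w U. y e) = (\<Sum>u | u \<in> U \<and> {w, u} \<in> E. y {w, u})"
    by (simp add: sum.reindex)
  also have "\<dots> = (\<Sum>u\<in>U. y {w, u})"
    using assms by (intro sum.mono_neutral_left) auto
  finally show ?thesis .
qed

lemma sum_of_bool_mem:
  fixes f :: "'a::finite \<Rightarrow> real"
  shows "(\<Sum>u\<in>UNIV. f u * of_bool (u \<in> A)) = (\<Sum>u\<in>A. f u)"
  by (simp add: sum.mono_neutral_cong_right[of UNIV A])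

text \<open>Weak duality. A member of \<open>K\<close> cannot be matched within \<open>K\<close> or
  with a common neighbour, so the rows of \<open>K\<close> total at most the capacity of the
  remaining vertices \<open>D\<close>. The rows of the other two classes obey their own capacities;
  inserting all this into the degree condition gives the bound.\<close>

lemma clique_inequality_if_transitions:
  assumes T: "transitions V E x y z"
    and K: "clique V E K" "K \<subseteq> nbrs E w"
  shows "(\<Sum>u\<in>common_nbrs V E (K \<union> {w}). y {w, u}) + 2 * (\<Sum>u\<in>K. y {w, u}) \<le> 2 * x w"
proof -
  let ?b = "\<lambda>u. y {w, u}" and ?C = "common_nbrs V E (K \<union> {w})"
  let ?r = "\<lambda>u. \<Sum>v\<in>UNIV. z w u v"
  define D where "D = - K - ?C"
  have y0: "0 \<le> ?b u" for u using T by (simp add: transitions_def)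
  have fm: "fractional_matching (turn E w) ?b (z w)" using T by (simp add: transitions_def)
  then have nn: "\<And>u v. 0 \<le> z w u v" and zs: "\<And>u v. z w u v = z w v u"
    and supp: "\<And>u v. \<not> turn E w u v \<Longrightarrow> z w u v = 0" and row: "\<And>u. ?r u \<le> ?b u"
    unfolding fractional_matching_def by blast+
  have KC: "K \<inter> ?C = {}" by (auto simp: common_nbrs_def)
  have split: "(\<Sum>u\<in>UNIV. f u) = (\<Sum>u\<in>K. f u) + (\<Sum>u\<in>?C. f u) + (\<Sum>u\<in>D. f u)" for f :: "_ \<Rightarrow> real"
  proof -
    have "UNIV = K \<union> ?C \<union> D" by (auto simp: D_def)
    moreover have "(\<Sum>u\<in>K \<union> ?C \<union> D. f u) = (\<Sum>u\<in>K \<union> ?C. f u) + (\<Sum>u\<in>D. f u)"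
      by (rule sum.union_disjoint) (auto simp: D_def)
    moreover have "(\<Sum>u\<in>K \<union> ?C. f u) = (\<Sum>u\<in>K. f u) + (\<Sum>u\<in>?C. f u)"
      by (rule sum.union_disjoint) (use KC in auto)
    ultimately show ?thesis by simp
  qed
  have z0: "z w u v = 0" if "u \<in> K" "v \<notin> D" for u v
  proof (rule supp)
    have "u = v \<or> {u, v} \<in> E"
      using that K(1) by (auto simp: D_def clique_def common_nbrs_def insert_commute)
    then show "\<not> turn E w u v" by (auto simp: turn_def)
  qed
  have "(\<Sum>u\<in>K. ?r u) = (\<Sum>u\<in>K. \<Sum>v\<in>D. z w u v)"
    by (intro sum.cong[OF refl] sum.mono_neutral_right) (auto simp: z0)
  also have "\<dots> = (\<Sum>v\<in>D. \<Sum>u\<in>K. z w v u)"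
    using sum.swap[of "z w" D K] zs by simp
  also have "\<dots> \<le> (\<Sum>v\<in>D. ?r v)"
    by (intro sum_mono sum_mono2) (auto simp: nn)
  also have "\<dots> \<le> (\<Sum>v\<in>D. ?b v)"
    by (intro sum_mono row)
  finally have "(\<Sum>u\<in>K. ?r u) \<le> (\<Sum>v\<in>D. ?b v)" .
  moreover have "(\<Sum>u\<in>?C. ?r u) \<le> (\<Sum>u\<in>?C. ?b u)" "(\<Sum>u\<in>D. ?r u) \<le> (\<Sum>u\<in>D. ?b u)"
    by (intro sum_mono row)+
  moreover have "(\<Sum>u\<in>UNIV. ?b u) \<le> x w + (\<Sum>u\<in>UNIV. ?r u) / 2"
    using T by (simp add: transitions_def)
  ultimately show ?thesis using split[of ?b] split[of ?r] by argo
qed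

text \<open>From left to right, duality is applied at each vertex: the stable set \<open>A\<close>,
  cut down to the neighbours of \<open>w\<close>, is a clique, and its inequality controls the dual
  value. The converse is weak duality.\<close>

lemma cone_P_iff_transitions:
  assumes G: "fin_simple_graph V E"
  shows "(x, y) \<in> cone_P V E \<longleftrightarrow> (\<exists>z. transitions V E (\<lambda>v. x $ v) (\<lambda>e. y $ e) z)"
proof
  assume "\<exists>z. transitions V E (\<lambda>v. x $ v) (\<lambda>e. y $ e) z"
  then obtain z where T: "transitions V E (\<lambda>v. x $ v) (\<lambda>e. y $ e) z" ..
  have y0: "y $ e = 0" if "e \<notin> E" for e using T that by (simp add: transitions_def)
  \<comment> \<open>The inequality of the empty clique has a nonnegative left side.\<close>
  have "0 \<le> x $ w" for w
    using clique_inequality_if_transitions[OF T, of "{}" w] T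
      sum_nonneg[of "common_nbrs V E {w}" "\<lambda>u. y $ {w, u}"]
    by (simp add: transitions_def clique_def)
  then show "(x, y) \<in> cone_P V E"
    using T clique_inequality_if_transitions[OF T]
    by (simp add: cone_P_def graph_space_def sum_edges_between[OF y0] transitions_def)
next
  assume P: "(x, y) \<in> cone_P V E"
  then have y0: "y $ e = 0" if "e \<notin> E" for e
    using that by (auto simp: cone_P_def graph_space_def)
  have ynn: "0 \<le> y $ e" for e
    using P y0 by (cases "e \<in> E") (auto simp: cone_P_def)
  have x0: "x $ v = 0" if "v \<notin> V" for v
    using P that by (auto simp: cone_P_def graph_space_def)
  have ineq: "(\<Sum>u\<in>common_nbrs V E (K \<union> {w}). y $ {w, u}) + 2 * (\<Sum>u\<in>K. y $ {w, u}) \<le> 2 * x $ w"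
    if "w \<in> V" "clique V E K" "K \<subseteq> nbrs E w" for w K
    using P that by (simp add: cone_P_def sum_edges_between[OF y0])
  have "\<exists>z. fractional_matching (turn E w) (\<lambda>u. y $ {w, u}) z \<and>
    (\<Sum>u\<in>UNIV. y $ {w, u}) \<le> x $ w + (\<Sum>u\<in>UNIV. \<Sum>v\<in>UNIV. z u v) / 2" for w
  proof -
    let ?b = "\<lambda>u. y $ {w, u}"
    have irr: "\<not> turn E w u u" for u by (simp add: turn_def)
    obtain z A where fm: "fractional_matching (turn E w) ?b z"
      and A: "\<And>u v. u \<in> A \<Longrightarrow> v \<in> A \<Longrightarrow> \<not> turn E w u v"
      and tot: "(\<Sum>u\<in>UNIV. \<Sum>v\<in>UNIV. z u v) = (\<Sum>u\<in>-A. ?b u) + (\<Sum>v | \<exists>u\<in>A. turn E w u v. ?b v)"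
      using fractional_matching_duality[of ?b "turn E w", OF ynn turn_sym irr] by blast
    let ?B = "{v. \<exists>u\<in>A. turn E w u v}"
    define K where "K = A \<inter> nbrs E w"
    let ?C = "common_nbrs V E (K \<union> {w})"
    \<comment> \<open>Twice the edge mass at \<open>w\<close> minus the dual value; this bound is
      the degree condition of \<open>transitions\<close>.\<close>
    have "2 * (\<Sum>u\<in>UNIV. ?b u) - (\<Sum>u\<in>-A. ?b u) - (\<Sum>v\<in>?B. ?b v) \<le> 2 * x $ w"
    proof (cases "w \<in> V")
      case False
      then have "?b u = 0" for u using y0 edge_subset[OF G] by blast
      then show ?thesis using x0[OF False] by simp
    next
      case True
      have cl: "clique V E K"
        using A edge_subset[OF G] by (auto simp: clique_def K_def nbrs_def turn_def)
      \<comment> \<open>Compare coefficients at a neighbour \<open>u\<close>: on \<open>A\<close> it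
        is 2 and \<open>u\<close> lies in \<open>K\<close>; outside \<open>A\<close> and
        \<open>?B\<close> it is 1 and \<open>u\<close> is adjacent to all of \<open>K\<close>; on
        \<open>?B\<close> it is 0.\<close>
      have "?b u * 2 - ?b u * of_bool (u \<in> -A) - ?b u * of_bool (u \<in> ?B)
          \<le> ?b u * of_bool (u \<in> ?C) + 2 * (?b u * of_bool (u \<in> K))" for u
      proof (cases "{w, u} \<in> E")
        case False
        then show ?thesis using y0 by simp
      next
        case wu: True
        have "u \<in> ?C" if "u \<notin> A" "u \<notin> ?B"
          using wu that edge_subset[OF G wu] edge_distinct[OF G wu]
          by (auto simp: common_nbrs_def K_def nbrs_def turn_def insert_commute)
        moreover have "u \<in> K" "u \<notin> ?B" if "u \<in> A"
          using wu that A by (auto simp: K_def nbrs_def)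
        ultimately show ?thesis
          using ynn[of "{w, u}"] by (cases "u \<in> A"; cases "u \<in> ?B") auto
      qed
      then have "(\<Sum>u\<in>UNIV. ?b u * 2 - ?b u * of_bool (u \<in> -A) - ?b u * of_bool (u \<in> ?B))
          \<le> (\<Sum>u\<in>UNIV. ?b u * of_bool (u \<in> ?C) + 2 * (?b u * of_bool (u \<in> K)))"
        by (intro sum_mono)
      then have "2 * (\<Sum>u\<in>UNIV. ?b u) - (\<Sum>u\<in>-A. ?b u) - (\<Sum>v\<in>?B. ?b v)
          \<le> (\<Sum>u\<in>?C. ?b u) + 2 * (\<Sum>u\<in>K. ?b u)"
        unfolding sum.distrib sum_subtractf sum_of_bool_mem sum_distrib_left[symmetric]
          sum_distrib_right[symmetric] by simp
      also have "\<dots> \<le> 2 * x $ w"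
        by (rule ineq[OF True cl]) (simp add: K_def)
      finally show ?thesis .
    qed
    then have "(\<Sum>u\<in>UNIV. ?b u) \<le> x $ w + (\<Sum>u\<in>UNIV. \<Sum>v\<in>UNIV. z u v) / 2"
      unfolding tot by argo
    then show ?thesis using fm by blast
  qed
  then obtain z where "\<And>w. fractional_matching (turn E w) (\<lambda>u. y $ {w, u}) (z w) \<and>
    (\<Sum>u\<in>UNIV. y $ {w, u}) \<le> x $ w + (\<Sum>u\<in>UNIV. \<Sum>v\<in>UNIV. z w u v) / 2"
    by metis
  then show "\<exists>z. transitions V E (\<lambda>v. x $ v) (\<lambda>e. y $ e) z"
    using x0 y0 ynn by (auto simp: transitions_def)
qed

section \<open>Walks\<close>

text \<open>Multiplicities instead of sets, since a walk may repeat vertices and edges; they are 0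
  or 1 once the list is distinct.\<close>

definition vertex_mult :: "'v list \<Rightarrow> 'v \<Rightarrow> real" where
  "vertex_mult p v = real (count_list p v)"

fun edge_mult :: "'v list \<Rightarrow> 'v set \<Rightarrow> real" where
  "edge_mult (a # b # p) e = of_bool (e = {a, b}) + edge_mult (b # p) e"
| "edge_mult _ e = 0"

text \<open>A passage through \<open>w\<close> is recorded in both orders of its outer vertices, in
  line with the symmetric matrices of matchings, and so adds 2 to the total at
  \<open>w\<close>.\<close>

fun turn_mult :: "'v list \<Rightarrow> 'v \<Rightarrow> 'v \<Rightarrow> 'v \<Rightarrow> real" where
  "turn_mult (a # b # c # p) w u v = of_bool (w = b) * pair_ind a c u v + turn_mult (b # c # p) w u v"
| "turn_mult _ w u v = 0"

section \<open>Supports, reversal and counting identities of walks\<close>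

lemma edge_mult_nonneg: "0 \<le> edge_mult p e"
  by (induction p e rule: edge_mult.induct) auto

lemma turn_mult_nonneg: "0 \<le> turn_mult p w u v"
  by (induction p w u v rule: turn_mult.induct) (auto simp: pair_ind_nonneg)

lemma turn_mult_sym: "turn_mult p w u v = turn_mult p w v u"
proof (induction p w u v rule: turn_mult.induct)
  case (1 a b c p w u v)
  then show ?case using pair_ind_sym[of a c u v] by simp
qed auto

lemma ex_nat_split: "(\<exists>i::nat. P i) \<longleftrightarrow> P 0 \<or> (\<exists>i. P (Suc i))"
  by (metis nat.exhaust)

lemma edge_mult_neq_0_iff:
  "edge_mult p e \<noteq> 0 \<longleftrightarrow> (\<exists>i. Suc i < length p \<and> e = {p ! i, p ! Suc i})"
proof (induction p e rule: edge_mult.induct)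
  case (1 a b p e)
  have "edge_mult (a # b # p) e \<noteq> 0 \<longleftrightarrow> e = {a, b} \<or> edge_mult (b # p) e \<noteq> 0"
    using edge_mult_nonneg[of "b # p" e] by auto
  moreover have "(\<exists>i. Suc i < length (a # b # p) \<and> e = {(a # b # p) ! i, (a # b # p) ! Suc i})
      \<longleftrightarrow> e = {a, b} \<or> (\<exists>i. Suc i < length (b # p) \<and> e = {(b # p) ! i, (b # p) ! Suc i})"
    by (rule trans[OF ex_nat_split]) simp
  ultimately show ?case unfolding 1 by (rule trans[OF _ sym])
qed simp_all

lemma pair_ind_neq_0_iff: "pair_ind a c u v \<noteq> 0 \<longleftrightarrow> u = a \<and> v = c \<or> u = c \<and> v = a"
proof -
  have "(of_bool P + of_bool Q :: real) \<noteq> 0 \<longleftrightarrow> P \<or> Q" for P Q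
    by (cases P; cases Q) auto
  then show ?thesis unfolding pair_ind_def .
qed

lemma turn_mult_neq_0_iff:
  "turn_mult p w u v \<noteq> 0 \<longleftrightarrow> (\<exists>i. Suc (Suc i) < length p \<and> w = p ! Suc i \<and>
     (u = p ! i \<and> v = p ! Suc (Suc i) \<or> u = p ! Suc (Suc i) \<and> v = p ! i))"
proof (induction p w u v rule: turn_mult.induct)
  case (1 a b c p w u v)
  have "of_bool P * s + t \<noteq> 0 \<longleftrightarrow> P \<and> s \<noteq> 0 \<or> t \<noteq> 0" if "0 \<le> s" "0 \<le> t" for P and s t :: real
    using that by (cases P) auto
  from this[OF pair_ind_nonneg turn_mult_nonneg]
  have "turn_mult (a # b # c # p) w u v \<noteq> 0 \<longleftrightarrow>
      w = b \<and> (u = a \<and> v = c \<or> u = c \<and> v = a) \<or> turn_mult (b # c # p) w u v \<noteq> 0"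
    by (simp only: turn_mult.simps pair_ind_neq_0_iff)
  moreover have "(\<exists>i. Suc (Suc i) < length (a # b # c # p) \<and> w = (a # b # c # p) ! Suc i \<and>
        (u = (a # b # c # p) ! i \<and> v = (a # b # c # p) ! Suc (Suc i) \<or>
         u = (a # b # c # p) ! Suc (Suc i) \<and> v = (a # b # c # p) ! i))
      \<longleftrightarrow> w = b \<and> (u = a \<and> v = c \<or> u = c \<and> v = a) \<or>
        (\<exists>i. Suc (Suc i) < length (b # c # p) \<and> w = (b # c # p) ! Suc i \<and>
        (u = (b # c # p) ! i \<and> v = (b # c # p) ! Suc (Suc i) \<or>
         u = (b # c # p) ! Suc (Suc i) \<and> v = (b # c # p) ! i))"
    by (rule trans[OF ex_nat_split]) simp
  ultimately show ?case unfolding 1 by (rule trans[OF _ sym])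
qed simp_all

lemma edge_mult_Cons_neq_0:
  "edge_mult (a # b # p) {a, b} \<noteq> 0" "edge_mult (b # p) e \<noteq> 0 \<Longrightarrow> edge_mult (a # b # p) e \<noteq> 0"
  using edge_mult_nonneg[of "b # p"] by (simp_all add: add_nonneg_eq_0_iff)

lemma edge_mult_subset: "edge_mult p e \<noteq> 0 \<Longrightarrow> e \<subseteq> set p"
  by (auto simp: edge_mult_neq_0_iff)

lemma edge_mult_snoc: "edge_mult (p @ [a, b]) e = edge_mult (p @ [a]) e + of_bool (e = {a, b})"
  by (induction p e rule: edge_mult.induct) auto

lemma turn_mult_snoc:
  "turn_mult (p @ [a, b, c]) w u v = turn_mult (p @ [a, b]) w u v + of_bool (w = b) * pair_ind a c u v"
  by (induction p w u v rule: turn_mult.induct) auto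

lemma edge_mult_rev: "edge_mult (rev p) e = edge_mult p e"
  by (induction p e rule: edge_mult.induct) (auto simp: edge_mult_snoc insert_commute)

lemma pair_ind_swap: "pair_ind a c = pair_ind c a"
  unfolding pair_ind_def by (intro ext add.commute)

lemma turn_mult_rev: "turn_mult (rev p) w u v = turn_mult p w u v"
  by (induction p w u v rule: turn_mult.induct)
    (auto simp: turn_mult_snoc pair_ind_swap)

text \<open>Seen from \<open>w\<close>, each traversal of \<open>{w, u}\<close> either continues
  through \<open>w\<close> as a turn or has \<open>w\<close> as an end of the walk; the two
  indicators count the ends. As edges have two elements, \<open>w\<close> is only one end of the
  traversal.\<close>

lemma edge_mult_row:
  fixes p :: "'v::finite list"
  assumes "\<And>e. edge_mult p e \<noteq> 0 \<Longrightarrow> card e = 2" "2 \<le> length p"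
  shows "edge_mult p {w, u} = (\<Sum>v\<in>UNIV. turn_mult p w u v)
    + of_bool (w = hd p \<and> u = hd (tl p)) + of_bool (w = last p \<and> u = last (butlast p))"
  using assms
proof (induction p rule: induct_list012)
  case (3 a b p)
  have ab: "a \<noteq> b" using 3(3)[OF edge_mult_Cons_neq_0(1)] by (cases "a = b") auto
  show ?case
  proof (cases p)
    case Nil
    then show ?thesis using ab by (auto simp: doubleton_eq_iff)
  next
    case (Cons c q)
    have "edge_mult (b # p) e \<noteq> 0 \<Longrightarrow> card e = 2" for e
      by (rule 3(3)) (rule edge_mult_Cons_neq_0(2))
    with 3(2) Cons have IH: "edge_mult (b # p) {w, u} = (\<Sum>v\<in>UNIV. turn_mult (b # p) w u v)
      + of_bool (w = b \<and> u = c) + of_bool (w = last p \<and> u = last (butlast (b # p)))"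
      by simp
    have "(\<Sum>v\<in>UNIV. turn_mult (a # b # p) w u v) =
        of_bool (w = b) * (of_bool (u = a) + of_bool (u = c)) + (\<Sum>v\<in>UNIV. turn_mult (b # p) w u v)"
      using sum_scaled_pair_ind(1)[of "of_bool (w = b)" a c u]
      by (simp add: Cons sum.distrib distrib_left)
    then show ?thesis using IH ab by (auto simp: Cons doubleton_eq_iff)
  qed
qed auto

lemma sum_edge_ind:
  fixes a b :: "'v::finite"
  assumes "a \<noteq> b"
  shows "(\<Sum>u\<in>UNIV. of_bool ({w, u} = {a, b}) :: real) = of_bool (w = a) + of_bool (w = b)"
proof -
  have "of_bool ({w, u} = {a, b}) = (of_bool (w = a \<and> u = b) + of_bool (w = b \<and> u = a) :: real)" for u
    using assms by (auto simp: doubleton_eq_iff)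
  then show ?thesis by (simp add: sum.distrib sum_of_bool_eq_conj)
qed

text \<open>An interior occurrence of \<open>w\<close> lies on two steps and adds 2 to the turn
  total, an end lies on one step and has no turn: 2 = 1 + 2/2 and 1 = 1 + 0.\<close>

lemma vertex_mult_eq:
  fixes p :: "'v::finite list"
  assumes "\<And>e. edge_mult p e \<noteq> 0 \<Longrightarrow> card e = 2" "2 \<le> length p"
  shows "(\<Sum>u\<in>UNIV. edge_mult p {w, u})
    = vertex_mult p w + (\<Sum>u\<in>UNIV. \<Sum>v\<in>UNIV. turn_mult p w u v) / 2"
  using assms
proof (induction p rule: induct_list012)
  case (3 a b p)
  have ab: "a \<noteq> b" using 3(3)[OF edge_mult_Cons_neq_0(1)] by (cases "a = b") auto
  show ?case
  proof (cases p)
    case Nil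
    then show ?thesis using sum_edge_ind[OF ab] ab by (simp add: vertex_mult_def)
  next
    case (Cons c q)
    have "edge_mult (b # p) e \<noteq> 0 \<Longrightarrow> card e = 2" for e
      by (rule 3(3)) (rule edge_mult_Cons_neq_0(2))
    with 3(2) Cons have IH: "(\<Sum>u\<in>UNIV. edge_mult (b # p) {w, u})
      = vertex_mult (b # p) w + (\<Sum>u\<in>UNIV. \<Sum>v\<in>UNIV. turn_mult (b # p) w u v) / 2"
      by simp
    have "(\<Sum>u\<in>UNIV. \<Sum>v\<in>UNIV. turn_mult (a # b # p) w u v) =
        2 * of_bool (w = b) + (\<Sum>u\<in>UNIV. \<Sum>v\<in>UNIV. turn_mult (b # p) w u v)"
      using sum_scaled_pair_ind(2)[of "of_bool (w = b)" a c]
      by (simp add: Cons sum.distrib)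
    moreover have "(\<Sum>u\<in>UNIV. edge_mult (a # b # p) {w, u})
        = of_bool (w = a) + of_bool (w = b) + (\<Sum>u\<in>UNIV. edge_mult (b # p) {w, u})"
      using sum_edge_ind[OF ab] by (simp add: sum.distrib)
    moreover have "vertex_mult (a # b # p) w = of_bool (w = a) + vertex_mult (b # p) w"
      by (simp add: vertex_mult_def)
    ultimately show ?thesis unfolding IH by argo
  qed
qed auto

lemma sum_vertex_mult:
  assumes "finite V" "set p \<subseteq> V"
  shows "(\<Sum>v\<in>V. vertex_mult p v) = length p"
  using assms sum_count_set[of p V] by (simp add: vertex_mult_def flip: of_nat_sum)

lemma sum_edge_mult:
  assumes "finite E" "\<And>e. edge_mult p e \<noteq> 0 \<Longrightarrow> e \<in> E" "p \<noteq> []"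
  shows "(\<Sum>e\<in>E. edge_mult p e) = length p - 1"
  using assms(2,3)
proof (induction p rule: induct_list012)
  case (3 a b p)
  have "{a, b} \<in> E" using 3(3)[OF edge_mult_Cons_neq_0(1)] .
  then have "(\<Sum>e\<in>E. of_bool (e = {a, b}) :: real) = 1"
    using assms(1) by (simp add: of_bool_def)
  moreover have "edge_mult (b # p) e \<noteq> 0 \<Longrightarrow> e \<in> E" for e
    by (rule 3(3)) (rule edge_mult_Cons_neq_0(2))
  ultimately show ?case using 3(2) by (simp add: sum.distrib)
qed auto

text \<open>Only a local condition: steps are edges and three consecutive vertices induce a path.
  Repetitions and longer chords are still possible.\<close>

definition locally_induced :: "'v set set \<Rightarrow> 'v list \<Rightarrow> bool" where
  "locally_induced E p \<longleftrightarrow> (\<forall>e. edge_mult p e \<noteq> 0 \<longrightarrow> e \<in> E) \<and>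
    (\<forall>w u v. turn_mult p w u v \<noteq> 0 \<longrightarrow> turn E w u v)"

text \<open>From two vertices on, the row identity without its end terms gives the capacities and
  the degree identity the last condition; a shorter walk has neither edges nor turns.\<close>

lemma transitions_walk:
  fixes V :: "'v::finite set"
  assumes G: "fin_simple_graph V E" and p: "locally_induced E p" "set p \<subseteq> V"
  shows "transitions V E (vertex_mult p) (edge_mult p) (turn_mult p)"
proof -
  have card: "edge_mult p e \<noteq> 0 \<Longrightarrow> card e = 2" for e
    using G p by (auto simp: locally_induced_def fin_simple_graph_def)
  have row: "(\<Sum>v\<in>UNIV. turn_mult p w u v) \<le> edge_mult p {w, u}" for w u
  proof (cases "2 \<le> length p")
    case True
    then show ?thesis using edge_mult_row[OF card True] by simp
  next
    case False
    then have "turn_mult p w u v = 0" for v using turn_mult_neq_0_iff[of p w u v] by auto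
    then show ?thesis by (simp add: edge_mult_nonneg)
  qed
  have deg: "(\<Sum>u\<in>UNIV. edge_mult p {w, u})
    \<le> vertex_mult p w + (\<Sum>u\<in>UNIV. \<Sum>v\<in>UNIV. turn_mult p w u v) / 2" for w
  proof (cases "2 \<le> length p")
    case True
    then show ?thesis using vertex_mult_eq[OF card True] by simp
  next
    case False
    then have "edge_mult p e = 0" for e using edge_mult_neq_0_iff[of p e] by auto
    then show ?thesis by (simp add: vertex_mult_def turn_mult_nonneg sum_nonneg)
  qed
  have "vertex_mult p v = 0" if "v \<notin> V" for v
    using that p(2) by (auto simp: vertex_mult_def count_list_0_iff)
  moreover have "fractional_matching (turn E w) (\<lambda>u. edge_mult p {w, u}) (turn_mult p w)" for w
    unfolding fractional_matching_def
  proof (intro conjI allI impI)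
    show "turn_mult p w u v = 0" if "\<not> turn E w u v" for u v
      using that p(1) unfolding locally_induced_def by blast
  qed (fact turn_mult_nonneg turn_mult_sym row)+
  moreover have "edge_mult p e = 0" if "e \<notin> E" for e
    using that p(1) unfolding locally_induced_def by blast
  ultimately show ?thesis
    using deg by (simp add: transitions_def edge_mult_nonneg)
qed

section \<open>Locally induced walks in chordal graphs are induced paths\<close>

lemma locally_induced_edge:
  assumes "locally_induced E p" "Suc i < length p"
  shows "{p ! i, p ! Suc i} \<in> E"
  using assms edge_mult_neq_0_iff[of p "{p ! i, p ! Suc i}"] unfolding locally_induced_def by blast

lemma locally_induced_turn:
  assumes "locally_induced E p" "Suc (Suc i) < length p"
  shows "turn E (p ! Suc i) (p ! i) (p ! Suc (Suc i))"
  using assms turn_mult_neq_0_iff[of p "p ! Suc i" "p ! i" "p ! Suc (Suc i)"]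
  unfolding locally_induced_def by blast

text \<open>Induction on the span \<open>j - i\<close>. A chord of minimal span closes its segment
  of the walk into an induced cycle of length at least 4.\<close>

lemma locally_induced_no_chord:
  assumes G: "fin_simple_graph V E" and ch: "chordal V E"
    and p: "locally_induced E p" "set p \<subseteq> V"
    and ij: "Suc (Suc i) \<le> j" "j < length p"
  shows "p ! i \<noteq> p ! j \<and> {p ! i, p ! j} \<notin> E"
  using ij
proof (induction "j - i" arbitrary: i j rule: less_induct)
  case less
  show ?case
  proof (rule ccontr)
    assume bad: "\<not> ?thesis"
    \<comment> \<open>Span 2 is excluded by the turn condition, so the segment has at least 4
      vertices.\<close>
    have "j \<noteq> Suc (Suc i)"
      using locally_induced_turn[OF p(1), of i] less.prems bad by (auto simp: turn_def)
    then have ij: "Suc (Suc (Suc i)) \<le> j" using less.prems by simp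
    have edge: "{p ! k, p ! Suc k} \<in> E" if "Suc k < length p" for k
      using locally_induced_edge[OF p(1) that] .
    \<comment> \<open>If the ends coincided, \<open>p ! i\<close> would be adjacent to
      \<open>p ! (j - 1)\<close>, a chord of smaller span.\<close>
    have ne: "p ! i \<noteq> p ! j"
    proof
      assume "p ! i = p ! j"
      then have "{p ! i, p ! (j - 1)} \<in> E"
        using edge[of "j - 1"] ij less.prems by (simp add: insert_commute)
      moreover have "j - 1 - i < j - i" "Suc (Suc i) \<le> j - 1" "j - 1 < length p"
        using ij less.prems by linarith+
      ultimately show False using less.hyps[of "j - 1" i] by blast
    qed
    then have e: "{p ! i, p ! j} \<in> E" using bad by blast
    define n where "n = Suc (j - i)"
    have n: "4 \<le> n" using ij by (simp add: n_def)
    define c where "c = map (\<lambda>k. p ! (i + k)) [0..<n]"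
    have len: "length c = n" and nth: "\<And>k. k < n \<Longrightarrow> c ! k = p ! (i + k)"
      by (simp_all add: c_def)
    have lt: "i + k < length p" if "k < n" for k using that less.prems by (simp add: n_def)
    \<comment> \<open>Consecutive vertices are joined by the walk and the two ends by the chord;
      every other pair has smaller span and falls under the induction hypothesis.\<close>
    have adj: "c ! k \<noteq> c ! l \<and> ({c ! k, c ! l} \<in> E \<longleftrightarrow> l = Suc k \<or> k = 0 \<and> l = n - 1)"
      if kl: "k < l" "l < n" for k l
    proof -
      consider "l = Suc k" | "k = 0" "l = n - 1" | "Suc (Suc k) \<le> l" "l - k < j - i"
        using kl unfolding n_def by linarith
      then show ?thesis
      proof cases
        case 1
        then have "{c ! k, c ! l} \<in> E" using edge[of "i + k"] lt[of l] kl by (simp add: nth)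
        then show ?thesis using 1 edge_distinct[OF G] by blast
      next
        case 2
        then show ?thesis using e ne kl less.prems by (simp add: nth n_def)
      next
        case 3
        then have "p ! (i + k) \<noteq> p ! (i + l) \<and> {p ! (i + k), p ! (i + l)} \<notin> E"
          using less.hyps[of "i + l" "i + k"] lt[of l] kl by auto
        then show ?thesis using 3 kl by (auto simp: nth n_def)
      qed
    qed
    have wrap: "Suc k mod n = (if Suc k = n then 0 else Suc k)" if "k < n" for k
      using that by simp
    have "induced_cycle V E c"
      unfolding induced_cycle_def len
    proof (intro conjI allI impI)
      show "3 \<le> n" using n by simp
      show "distinct c"
        unfolding distinct_conv_nth len using adj by (metis nat_neq_iff)
      show "set c \<subseteq> V" using p(2) lt by (auto simp: c_def)
      fix k l assume kl: "k < n" "l < n"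
      consider "k < l" | "k = l" | "l < k" by linarith
      then show "{c ! k, c ! l} \<in> E \<longleftrightarrow> l = Suc k mod n \<or> k = Suc l mod n"
      proof cases
        case 1
        then show ?thesis using adj[OF 1 kl(2)] kl n by (auto simp: wrap)
      next
        case 2
        have "{c ! k, c ! l} \<notin> E" using 2 edge_distinct[OF G] by blast
        then show ?thesis using 2 kl n by (auto simp: wrap)
      next
        case 3
        have "{c ! k, c ! l} = {c ! l, c ! k}" by (rule insert_commute)
        then show ?thesis using adj[OF 3 kl(1)] kl n 3 by (auto simp: wrap)
      qed
    qed
    then show False using ch n len unfolding chordal_def by auto
  qed
qed

text \<open>Besides giving 0/1 multiplicities, this bounds the length of such walks by the number of
  vertices.\<close>

lemma locally_induced_distinct:
  assumes G: "fin_simple_graph V E" and ch: "chordal V E"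
    and p: "locally_induced E p" "set p \<subseteq> V"
  shows "distinct p"
proof -
  have "p ! i \<noteq> p ! j" if "i < j" "j < length p" for i j
  proof (cases "j = Suc i")
    case True
    then show ?thesis using locally_induced_edge[OF p(1), of i] edge_distinct[OF G] that by auto
  next
    case False
    then show ?thesis using locally_induced_no_chord[OF G ch p, of i j] that by simp
  qed
  then show ?thesis unfolding distinct_conv_nth by (metis nat_neq_iff)
qed

section \<open>Decomposition into walks\<close>

text \<open>
  The walk is a longest one in the support of \<open>y\<close> and \<open>z\<close>. At its ends all turns vanish by
  maximality, so that the slack needed there for subtracting it is available.
\<close>

lemma peel_walk:
  fixes V :: "'v::finite set"
  assumes G: "fin_simple_graph V E" and ch: "chordal V E"
    and T: "transitions V E x y z" and y: "\<exists>e. y e \<noteq> 0"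
  obtains p r where "locally_induced E p" "set p \<subseteq> V" "p \<noteq> []" "0 \<le> r"
    "transitions V E (\<lambda>v. x v - r * vertex_mult p v) (\<lambda>e. y e - r * edge_mult p e)
      (\<lambda>w u v. z w u v - r * turn_mult p w u v)"
    "\<And>e. y e = 0 \<Longrightarrow> edge_mult p e = 0" "\<And>w u v. z w u v = 0 \<Longrightarrow> turn_mult p w u v = 0"
    "(\<exists>e. y e \<noteq> 0 \<and> y e = r * edge_mult p e) \<or>
      (\<exists>w u v. z w u v \<noteq> 0 \<and> z w u v = r * turn_mult p w u v)"
proof -
  have x0: "\<And>v. v \<notin> V \<Longrightarrow> x v = 0" and y0: "\<And>e. 0 \<le> y e" and yE: "\<And>e. e \<notin> E \<Longrightarrow> y e = 0"
    and fm: "\<And>w. fractional_matching (turn E w) (\<lambda>u. y {w, u}) (z w)"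
    and deg: "\<And>w. (\<Sum>u\<in>UNIV. y {w, u}) \<le> x w + (\<Sum>u\<in>UNIV. \<Sum>v\<in>UNIV. z w u v) / 2"
    using T by (simp_all add: transitions_def)
  have z0: "\<And>w u v. 0 \<le> z w u v" and zs: "\<And>w u v. z w u v = z w v u"
    and supp: "\<And>w u v. z w u v \<noteq> 0 \<Longrightarrow> turn E w u v"
    and row: "\<And>w u. (\<Sum>v\<in>UNIV. z w u v) \<le> y {w, u}"
    using fm unfolding fractional_matching_def by blast+
  have z_le: "z w u v \<le> y {w, v}" for w u v
  proof -
    have "z w v u \<le> (\<Sum>t\<in>UNIV. z w v t)" by (rule member_le_sum) (auto simp: z0)
    then show ?thesis using row[of w v] zs[of w u v] by simp
  qed
  \<comment> \<open>Walks inside the support, with at least one edge so that the row and degree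
    identities apply.\<close>
  define pos where "pos p \<longleftrightarrow> 2 \<le> length p \<and> (\<forall>e. edge_mult p e \<noteq> 0 \<longrightarrow> y e \<noteq> 0) \<and>
    (\<forall>w u v. turn_mult p w u v \<noteq> 0 \<longrightarrow> z w u v \<noteq> 0)" for p
  have pos_li: "locally_induced E p" if "pos p" for p
    using that yE supp unfolding pos_def locally_induced_def by blast
  have pos_V: "set p \<subseteq> V" if "pos p" for p
  proof
    fix v assume "v \<in> set p"
    then obtain i where i: "i < length p" "p ! i = v" by (auto simp: in_set_conv_nth)
    show "v \<in> V"
    proof (cases "Suc i < length p")
      case True
      then show ?thesis
        using locally_induced_edge[OF pos_li[OF that] True] edge_subset[OF G] i by blast
    next
      case False
      then have "Suc (i - 1) = i" using that i unfolding pos_def by simp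
      then show ?thesis
        using locally_induced_edge[OF pos_li[OF that], of "i - 1"] edge_subset[OF G] i by auto
    qed
  qed
  \<comment> \<open>Chordality enters here: distinctness bounds the length, so that a longest walk
    exists.\<close>
  have pos_len: "length p < Suc (card (UNIV :: 'v set))" if "pos p" for p
    using distinct_card[OF locally_induced_distinct[OF G ch pos_li[OF that] pos_V[OF that]]]
      card_mono[of UNIV "set p"] by simp
  obtain e where e: "y e \<noteq> 0" using y by blast
  then have "e \<in> E" using yE by blast
  then have "card e = 2" using G by (simp add: fin_simple_graph_def)
  then obtain a b where ab: "e = {a, b}" by (auto simp: card_2_iff)
  have "pos [a, b]" using e ab by (simp add: pos_def)
  then obtain p where p: "pos p" and longest: "\<And>q. pos q \<Longrightarrow> length q \<le> length p"
    using Lattices_Big.ex_has_greatest_nat[of pos "[a, b]" length] pos_len by blast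
  \<comment> \<open>A nonzero turn at the first edge would allow \<open>v\<close> to be prepended.
    Stated for every walk of maximal length, so that it also applies to
    \<open>rev p\<close>.\<close>
  have start: "z (hd q) (hd (tl q)) v = 0" if q: "pos q" "length q = length p" for q v
  proof (rule ccontr)
    assume z: "z (hd q) (hd (tl q)) v \<noteq> 0"
    obtain a b q' where q': "q = a # b # q'"
      using q(1) unfolding pos_def by (cases q; cases "tl q") auto
    have zab: "z a b v \<noteq> 0" using z q' by simp
    have "pos (v # q)"
      unfolding pos_def
    proof (intro conjI allI impI)
      show "2 \<le> length (v # q)" by (simp add: q')
    next
      fix e assume "edge_mult (v # q) e \<noteq> 0"
      then consider "e = {v, a}" | "edge_mult q e \<noteq> 0"
        by (cases "e = {v, a}") (auto simp: q')
      then show "y e \<noteq> 0"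
      proof cases
        case 1
        then show ?thesis using z_le[of a b v] zab z0[of a b v] by (simp add: insert_commute)
      next
        case 2
        then show ?thesis using q(1) by (simp add: pos_def)
      qed
    next
      fix w s t assume "turn_mult (v # q) w s t \<noteq> 0"
      then consider "w = a" "pair_ind v b s t \<noteq> 0" | "turn_mult q w s t \<noteq> 0"
        by (cases "w = a"; cases "pair_ind v b s t = 0") (auto simp: q')
      then show "z w s t \<noteq> 0"
      proof cases
        case 1
        then show ?thesis using zab zs[of a b v] unfolding pair_ind_neq_0_iff by auto
      next
        case 2
        then show ?thesis using q(1) by (simp add: pos_def)
      qed
    qed
    from longest[OF this] show False using q by simp
  qed
  have p2: "2 \<le> length p" using p by (simp add: pos_def)
  have start': "z w u v = 0" if "w = hd p" "u = hd (tl p)" for w u v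
    using start[OF p] that by simp
  have finish: "z w u v = 0" if "w = last p" "u = last (butlast p)" for w u v
  proof -
    have "pos (rev p)" using p by (simp add: pos_def edge_mult_rev turn_mult_rev)
    moreover have "hd (rev p) = last p" "hd (tl (rev p)) = last (butlast p)"
      using butlast_rev[of "rev p"] by (simp_all add: hd_rev last_rev)
    ultimately show ?thesis using start[of "rev p"] that by simp
  qed
  \<comment> \<open>The least ratio is the largest multiple of the walk that can be subtracted
    before an entry of \<open>y\<close> or \<open>z\<close> becomes negative.\<close>
  define R where "R = (\<lambda>e. y e / edge_mult p e) ` {e. edge_mult p e \<noteq> 0} \<union>
    (\<lambda>(w, u, v). z w u v / turn_mult p w u v) ` {(w, u, v). turn_mult p w u v \<noteq> 0}"
  define r where "r = Min R"
  have fR: "finite R" by (simp add: R_def)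
  have "edge_mult p {p ! 0, p ! Suc 0} \<noteq> 0"
    unfolding edge_mult_neq_0_iff using p2 by (intro exI[of _ 0]) simp
  then have neR: "R \<noteq> {}" unfolding R_def by blast
  have rR: "r \<in> R" unfolding r_def by (rule Min_in[OF fR neR])
  have r0: "0 \<le> r"
    using rR by (auto simp: R_def y0 z0 edge_mult_nonneg turn_mult_nonneg)
  have ry: "r * edge_mult p e \<le> y e" for e
  proof (cases "edge_mult p e = 0")
    case False
    then have "y e / edge_mult p e \<in> R" unfolding R_def by blast
    then have "r \<le> y e / edge_mult p e" unfolding r_def by (rule Min_le[OF fR])
    then show ?thesis using False edge_mult_nonneg[of p e] by (simp add: pos_le_divide_eq)
  qed (simp add: y0)
  have rz: "r * turn_mult p w u v \<le> z w u v" for w u v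
  proof (cases "turn_mult p w u v = 0")
    case False
    then have "z w u v / turn_mult p w u v \<in> R" unfolding R_def by force
    then have "r \<le> z w u v / turn_mult p w u v" unfolding r_def by (rule Min_le[OF fR])
    then show ?thesis using False turn_mult_nonneg[of p w u v] by (simp add: pos_le_divide_eq)
  qed (simp add: z0)
  have li: "locally_induced E p" by (rule pos_li[OF p])
  have pV: "set p \<subseteq> V" by (rule pos_V[OF p])
  have card: "edge_mult p e \<noteq> 0 \<Longrightarrow> card e = 2" for e
    using G li by (auto simp: locally_induced_def fin_simple_graph_def)
  have yp: "edge_mult p e = 0" if "y e = 0" for e using that p unfolding pos_def by blast
  have zp: "turn_mult p w u v = 0" if "z w u v = 0" for w u v using that p unfolding pos_def by blast
  \<comment> \<open>If row \<open>u\<close> of \<open>z w\<close> vanishes, the left side is 0 and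
    \<open>ry\<close> suffices. Otherwise \<open>start'\<close> and \<open>finish\<close> rule out
    both end terms, so the row identity makes both sides drop by the same amount.\<close>
  have row': "(\<Sum>v\<in>UNIV. z w u v - r * turn_mult p w u v) \<le> y {w, u} - r * edge_mult p {w, u}" for w u
  proof (cases "\<forall>v. z w u v = 0")
    case True
    then have "(\<Sum>v\<in>UNIV. z w u v - r * turn_mult p w u v) = 0" using zp by simp
    then show ?thesis using ry[of "{w, u}"] by simp
  next
    case False
    then have "edge_mult p {w, u} = (\<Sum>v\<in>UNIV. turn_mult p w u v)"
      using edge_mult_row[OF card p2, of w u] start'[of w u] finish[of w u] by auto
    then show ?thesis
      using row[of w u] by (simp add: sum_subtractf sum_distrib_left)
  qed
  \<comment> \<open>The degree identity is an equation, so the subtraction leaves the slack at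
    \<open>w\<close> unchanged.\<close>
  have deg': "(\<Sum>u\<in>UNIV. y {w, u} - r * edge_mult p {w, u}) \<le> x w - r * vertex_mult p w
    + (\<Sum>u\<in>UNIV. \<Sum>v\<in>UNIV. z w u v - r * turn_mult p w u v) / 2" for w
  proof -
    have "r * (\<Sum>u\<in>UNIV. edge_mult p {w, u}) =
        r * vertex_mult p w + r * (\<Sum>u\<in>UNIV. \<Sum>v\<in>UNIV. turn_mult p w u v) / 2"
      using vertex_mult_eq[OF card p2, of w] by (simp add: distrib_left)
    then show ?thesis
      using deg[of w] unfolding sum_subtractf sum_distrib_left[symmetric] by argo
  qed
  have tr: "transitions V E (\<lambda>v. x v - r * vertex_mult p v) (\<lambda>e. y e - r * edge_mult p e)
      (\<lambda>w u v. z w u v - r * turn_mult p w u v)"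
    unfolding transitions_def fractional_matching_def
  proof (intro conjI allI impI)
    show "x v - r * vertex_mult p v = 0" if "v \<notin> V" for v
    proof -
      have "v \<notin> set p" using that pV by blast
      then show ?thesis using x0[OF that] by (simp add: vertex_mult_def)
    qed
    show "y e - r * edge_mult p e = 0" if "e \<notin> E" for e
      using yE[OF that] yp by simp
    show "z w u v - r * turn_mult p w u v = 0" if "\<not> turn E w u v" for w u v
    proof -
      have "z w u v = 0" using supp that by blast
      then show ?thesis using zp by simp
    qed
    show "z w u v - r * turn_mult p w u v = z w v u - r * turn_mult p w v u" for w u v
      unfolding zs[of w u v] turn_mult_sym[of p w u v] ..
    show "0 \<le> y e - r * edge_mult p e" for e using ry[of e] by simp
    show "0 \<le> z w u v - r * turn_mult p w u v" for w u v using rz[of w u v] by simp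
  qed (fact row' deg')+
  \<comment> \<open>The minimum is attained, so some nonzero entry of \<open>y\<close> or
    \<open>z\<close> is cancelled exactly.\<close>
  have "(\<exists>e. y e \<noteq> 0 \<and> y e = r * edge_mult p e) \<or>
      (\<exists>w u v. z w u v \<noteq> 0 \<and> z w u v = r * turn_mult p w u v)"
  proof -
    consider e where "edge_mult p e \<noteq> 0" "r = y e / edge_mult p e"
      | w u v where "turn_mult p w u v \<noteq> 0" "r = z w u v / turn_mult p w u v"
      using rR unfolding R_def by auto
    then show ?thesis
    proof cases
      case 1
      then have "y e = r * edge_mult p e" "y e \<noteq> 0" using yp by auto
      then show ?thesis by blast
    next
      case 2
      then have "z w u v = r * turn_mult p w u v" "z w u v \<noteq> 0" using zp by auto
      then show ?thesis by blast
    qed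
  qed
  moreover have "p \<noteq> []" using p2 by auto
  ultimately show thesis using that[OF li pV _ r0 tr yp zp] by blast
qed

section \<open>Walk vectors generate the cone\<close>

definition walk_vec :: "'v::finite list \<Rightarrow> (real^'v) \<times> (real^'v set)" where
  "walk_vec p = (\<chi> v. vertex_mult p v, \<chi> e. edge_mult p e)"

definition induced_walks :: "'v set \<Rightarrow> 'v set set \<Rightarrow> 'v list set" where
  "induced_walks V E = {p. p \<noteq> [] \<and> set p \<subseteq> V \<and> locally_induced E p}"

lemma singleton_in_induced_walks: "v \<in> V \<Longrightarrow> [v] \<in> induced_walks V E"
  by (simp add: induced_walks_def locally_induced_def)

lemma convex_cone_hull_sum:
  assumes "\<And>a. a \<in> A \<Longrightarrow> f a \<in> convex_cone hull S"
  shows "sum f A \<in> convex_cone hull S"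
  using assms
  by (induction A rule: infinite_finite_induct)
    (simp_all add: convex_cone_hull_contains_0 convex_cone_hull_add)

text \<open>Induction on the number of nonzero entries of \<open>y\<close> and \<open>z\<close>:
  peeling off a walk creates none and removes at least one. Once \<open>y\<close> is 0, only
  multiples of one-vertex walks remain.\<close>

lemma transitions_imp_cone_hull:
  fixes V :: "'v::finite set"
  assumes G: "fin_simple_graph V E" and ch: "chordal V E"
  assumes "transitions V E x y z"
  shows "(\<chi> v. x v, \<chi> e. y e) \<in> convex_cone hull (walk_vec ` induced_walks V E)"
  using assms(3)
proof (induction "card {e. y e \<noteq> 0} + card {(w, u, v). z w u v \<noteq> 0}" arbitrary: x y z rule: less_induct)
  case less
  let ?C = "convex_cone hull (walk_vec ` induced_walks V E)"
  show ?case
  proof (cases "\<exists>e. y e \<noteq> 0")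
    case True
    obtain p r where p: "locally_induced E p" "set p \<subseteq> V" "p \<noteq> []" and r: "0 \<le> r"
      and T: "transitions V E (\<lambda>v. x v - r * vertex_mult p v) (\<lambda>e. y e - r * edge_mult p e)
        (\<lambda>w u v. z w u v - r * turn_mult p w u v)"
      and yp: "\<And>e. y e = 0 \<Longrightarrow> edge_mult p e = 0"
      and zp: "\<And>w u v. z w u v = 0 \<Longrightarrow> turn_mult p w u v = 0"
      and kill: "(\<exists>e. y e \<noteq> 0 \<and> y e = r * edge_mult p e) \<or>
        (\<exists>w u v. z w u v \<noteq> 0 \<and> z w u v = r * turn_mult p w u v)"
      by (rule peel_walk[OF G ch less.prems True]) (rule that)
    let ?Y = "{e. y e \<noteq> 0}" and ?Y' = "{e. y e - r * edge_mult p e \<noteq> 0}"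
    let ?Z = "{(w, u, v). z w u v \<noteq> 0}" and ?Z' = "{(w, u, v). z w u v - r * turn_mult p w u v \<noteq> 0}"
    have sub: "?Y' \<subseteq> ?Y" "?Z' \<subseteq> ?Z" using yp zp by auto
    have "?Y' \<subset> ?Y \<or> ?Z' \<subset> ?Z" using sub kill by fastforce
    moreover have "card ?Y' \<le> card ?Y" "card ?Z' \<le> card ?Z" using sub by (auto intro: card_mono)
    moreover have "?Y' \<subset> ?Y \<Longrightarrow> card ?Y' < card ?Y" "?Z' \<subset> ?Z \<Longrightarrow> card ?Z' < card ?Z"
      by (rule psubset_card_mono[OF finite], assumption)+
    ultimately have "card ?Y' + card ?Z' < card ?Y + card ?Z" by linarith
    from less.hyps[OF this T]
    have rest: "(\<chi> v. x v - r * vertex_mult p v, \<chi> e. y e - r * edge_mult p e) \<in> ?C" .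
    have walk: "r *\<^sub>R walk_vec p \<in> ?C"
      using p r by (intro convex_cone_hull_mul hull_inc) (auto simp: induced_walks_def)
    have "(\<chi> v. x v, \<chi> e. y e) =
        (\<chi> v. x v - r * vertex_mult p v, \<chi> e. y e - r * edge_mult p e) + r *\<^sub>R walk_vec p"
      by (simp add: walk_vec_def vec_eq_iff)
    also have "\<dots> \<in> ?C" by (rule convex_cone_hull_add[OF rest walk])
    finally show ?thesis .
  next
    case False
    then have y: "y e = 0" for e by blast
    have T: "\<And>w. fractional_matching (turn E w) (\<lambda>u. y {w, u}) (z w)"
      "\<And>v. v \<notin> V \<Longrightarrow> x v = 0"
      "\<And>w. (\<Sum>u\<in>UNIV. y {w, u}) \<le> x w + (\<Sum>u\<in>UNIV. \<Sum>v\<in>UNIV. z w u v) / 2"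
      using less.prems by (simp_all add: transitions_def)
    \<comment> \<open>With zero capacities the matching total is at most 0, and the degree condition
      becomes nonnegativity of \<open>x w\<close>.\<close>
    have x: "0 \<le> x w" for w
    proof -
      have "(\<Sum>u\<in>UNIV. \<Sum>v\<in>UNIV. z w u v) \<le> 0"
        by (rule sum_nonpos) (use T(1)[of w] y in \<open>simp add: fractional_matching_def\<close>)
      then show ?thesis using T(3)[of w] y by simp
    qed
    have "(\<chi> v. x v, \<chi> e. y e) = (\<Sum>v\<in>V. x v *\<^sub>R walk_vec [v])"
    proof -
      have "(\<Sum>v\<in>V. x v * vertex_mult [v] u) = x u" for u
      proof -
        have "(\<Sum>v\<in>V. x v * vertex_mult [v] u) = (\<Sum>v\<in>V. if v = u then x v else 0)"
          by (intro sum.cong) (auto simp: vertex_mult_def)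
        also have "\<dots> = x u" using T(2)[of u] by simp
        finally show ?thesis .
      qed
      then show ?thesis
        by (simp add: prod_eq_iff fst_sum snd_sum walk_vec_def vec_eq_iff y)
    qed
    also have "\<dots> \<in> ?C"
      using x by (intro convex_cone_hull_sum convex_cone_hull_mul hull_inc imageI
          singleton_in_induced_walks)
    finally show ?thesis .
  qed
qed

section \<open>The polyhedron as a convex hull\<close>

lemma fractional_matching_combine:
  assumes "fractional_matching R b z" "fractional_matching R b' z'" "0 \<le> s" "0 \<le> t"
  shows "fractional_matching R (\<lambda>u. s * b u + t * b' u) (\<lambda>u v. s * z u v + t * z' u v)"
  using assms
  by (auto simp: fractional_matching_def sum.distrib intro!: add_mono mult_left_mono
      simp flip: sum_distrib_left)

text \<open>All conditions are linear and homogeneous in \<open>x\<close>, \<open>y\<close>,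
  \<open>z\<close> jointly. This serves convexity and, later, the points of an unbounded
  ray.\<close>

lemma transitions_combine:
  assumes "transitions V E x y z" "transitions V E x' y' z'" "0 \<le> s" "0 \<le> t"
  shows "transitions V E (\<lambda>v. s * x v + t * x' v) (\<lambda>e. s * y e + t * y' e)
    (\<lambda>w u v. s * z w u v + t * z' w u v)"
proof -
  have "(\<Sum>u\<in>UNIV. s * y {w, u} + t * y' {w, u}) \<le> s * x w + t * x' w
      + (\<Sum>u\<in>UNIV. \<Sum>v\<in>UNIV. s * z w u v + t * z' w u v) / 2" for w
  proof -
    have "s * (\<Sum>u\<in>UNIV. y {w, u}) \<le> s * (x w + (\<Sum>u\<in>UNIV. \<Sum>v\<in>UNIV. z w u v) / 2)"
      "t * (\<Sum>u\<in>UNIV. y' {w, u}) \<le> t * (x' w + (\<Sum>u\<in>UNIV. \<Sum>v\<in>UNIV. z' w u v) / 2)"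
      using assms by (auto simp: transitions_def intro!: mult_left_mono)
    then show ?thesis
      unfolding sum.distrib sum_distrib_left[symmetric] distrib_left by argo
  qed
  moreover have "fractional_matching (turn E w) (\<lambda>u. s * y {w, u} + t * y' {w, u})
      (\<lambda>u v. s * z w u v + t * z' w u v)" for w
    using assms by (intro fractional_matching_combine) (simp_all add: transitions_def)
  ultimately show ?thesis
    using assms by (simp add: transitions_def)
qed

text \<open>The linear functional of the hyperplane, the Euler characteristic: 1 on paths and 0 on
  cycles.\<close>

definition euler :: "'v::finite set \<Rightarrow> 'v set set \<Rightarrow> (real^'v) \<times> (real^'v set) \<Rightarrow> real" where
  "euler V E q = (\<Sum>v\<in>V. fst q $ v) - (\<Sum>e\<in>E. snd q $ e)"

lemma linear_euler: "linear (euler V E)"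
  by (intro linearI)
    (simp_all add: euler_def sum.distrib sum_distrib_left right_diff_distrib)

lemma polyhedron_P_iff: "q \<in> polyhedron_P V E \<longleftrightarrow> q \<in> cone_P V E \<and> euler V E q = 1"
  by (cases q) (simp add: polyhedron_P_def euler_def)

lemma convex_polyhedron_P:
  assumes G: "fin_simple_graph V E"
  shows "convex (polyhedron_P V E)"
proof (rule convexI)
  fix q q' :: "(real^'a) \<times> (real^'a set)" and s t :: real
  assume q: "q \<in> polyhedron_P V E" "q' \<in> polyhedron_P V E" and st: "0 \<le> s" "0 \<le> t" "s + t = 1"
  obtain x y x' y' where qx: "q = (x, y)" "q' = (x', y')" by fastforce
  obtain z z' where "transitions V E (\<lambda>v. x $ v) (\<lambda>e. y $ e) z"
    "transitions V E (\<lambda>v. x' $ v) (\<lambda>e. y' $ e) z'"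
    using q by (auto simp: polyhedron_P_iff qx cone_P_iff_transitions[OF G])
  from transitions_combine[OF this st(1,2)]
  have "s *\<^sub>R q + t *\<^sub>R q' \<in> cone_P V E"
    by (auto simp: qx cone_P_iff_transitions[OF G])
  moreover have "euler V E (s *\<^sub>R q + t *\<^sub>R q') = 1"
    using q st by (simp add: polyhedron_P_iff linear_add[OF linear_euler] linear_scale[OF linear_euler])
  ultimately show "s *\<^sub>R q + t *\<^sub>R q' \<in> polyhedron_P V E" by (simp add: polyhedron_P_iff)
qed

text \<open>A walk has one vertex occurrence more than it has steps, which is the hyperplane
  equation.\<close>

lemma walk_vec_in_polyhedron_P:
  fixes V :: "'v::finite set"
  assumes G: "fin_simple_graph V E" and p: "p \<in> induced_walks V E"
  shows "walk_vec p \<in> polyhedron_P V E"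
proof -
  have li: "p \<noteq> []" "set p \<subseteq> V" "locally_induced E p" using p by (simp_all add: induced_walks_def)
  have "walk_vec p \<in> cone_P V E"
    using transitions_walk[OF G li(3,2)] by (auto simp: walk_vec_def cone_P_iff_transitions[OF G])
  moreover have "euler V E (walk_vec p) = 1"
  proof -
    have "edge_mult p e \<noteq> 0 \<Longrightarrow> e \<in> E" for e using li(3) by (simp add: locally_induced_def)
    from sum_edge_mult[OF finite this li(1)] sum_vertex_mult[OF finite li(2)] li(1)
    show ?thesis by (cases p) (simp_all add: euler_def walk_vec_def)
  qed
  ultimately show ?thesis by (simp add: polyhedron_P_iff)
qed

text \<open>All generators of the cone have value 1 under \<open>euler\<close>, so the slice at
  level 1 is their convex hull.\<close>

lemma polyhedron_P_eq_convex_hull: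
  fixes V :: "'v::finite set"
  assumes G: "fin_simple_graph V E" and ch: "chordal V E"
  shows "polyhedron_P V E = convex hull (walk_vec ` induced_walks V E)"
proof
  let ?H = "convex hull (walk_vec ` induced_walks V E)"
  show "?H \<subseteq> polyhedron_P V E"
    using walk_vec_in_polyhedron_P[OF G] convex_polyhedron_P[OF G] by (intro hull_minimal) auto
  have euler_H: "euler V E h = 1" if "h \<in> ?H" for h
    using \<open>?H \<subseteq> polyhedron_P V E\<close> that by (auto simp: polyhedron_P_iff)
  show "polyhedron_P V E \<subseteq> ?H"
  proof
    fix q assume q: "q \<in> polyhedron_P V E"
    then have "q \<in> cone_P V E" and e: "euler V E q = 1" by (simp_all add: polyhedron_P_iff)
    moreover obtain x y where qx: "q = (x, y)" by fastforce
    ultimately obtain z where "transitions V E (\<lambda>v. x $ v) (\<lambda>e. y $ e) z"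
      by (auto simp: cone_P_iff_transitions[OF G])
    from transitions_imp_cone_hull[OF G ch this]
    have "q \<in> convex_cone hull (walk_vec ` induced_walks V E)" by (simp add: qx)
    \<comment> \<open>A nonzero point of the cone is a multiple of a point of the convex hull; as
      \<open>euler\<close> is 1 on both, the factor is 1.\<close>
    moreover have "q \<noteq> 0" using e linear_0[OF linear_euler, of V E] by auto
    ultimately obtain h c where h: "h \<in> ?H" "q = c *\<^sub>R h"
      by (auto simp: convex_cone_hull_convex_hull)
    then have "c = 1" using e euler_H[OF h(1)] by (simp add: linear_scale[OF linear_euler])
    then show "q \<in> ?H" using h by simp
  qed
qed

lemma distinct_edge_mult: "distinct p \<Longrightarrow> edge_mult p e \<in> {0, 1}"
proof (induction p rule: induct_list012)
  case (3 a b p)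
  \<comment> \<open>The vertex \<open>a\<close> does not recur, so the first edge cannot be
    traversed again.\<close>
  have "edge_mult (b # p) {a, b} = 0" using 3(3) edge_mult_subset[of "b # p" "{a, b}"] by auto
  then show ?case using 3 by (cases "e = {a, b}") auto
qed auto

lemma distinct_vertex_mult: "distinct p \<Longrightarrow> vertex_mult p v \<in> {0, 1}"
  by (induction p) (auto simp: vertex_mult_def)

text \<open>Distinct walks are finite in number, and every extreme point of their convex hull is one
  of the walk vectors, which are 0/1.\<close>

lemma chordal_imp_binary:
  fixes V :: "'v::finite set"
  assumes G: "fin_simple_graph V E" and ch: "chordal V E"
  shows "binary_polyhedron (polyhedron_P V E)"
proof -
  have dist: "distinct p" if "p \<in> induced_walks V E" for p
    using that locally_induced_distinct[OF G ch] by (auto simp: induced_walks_def)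
  then have "induced_walks V E \<subseteq> {p. set p \<subseteq> UNIV \<and> length p \<le> card (UNIV :: 'v set)}"
    by (auto simp: card_mono simp flip: distinct_card)
  then have "finite (induced_walks V E)"
    by (rule finite_subset) (rule finite_lists_length_le[OF finite])
  then have "polytope (polyhedron_P V E)"
    unfolding polyhedron_P_eq_convex_hull[OF G ch] polytope_def by blast
  moreover have "(\<forall>i. x $ i \<in> {0, 1}) \<and> (\<forall>j. y $ j \<in> {0, 1})"
    if "(x, y) extreme_point_of polyhedron_P V E" for x y
  proof -
    have "(x, y) \<in> walk_vec ` induced_walks V E"
      using that extreme_point_of_convex_hull unfolding polyhedron_P_eq_convex_hull[OF G ch] by blast
    then obtain p where p: "distinct p" "(x, y) = walk_vec p" using dist by blast
    then show ?thesis
      using distinct_vertex_mult[OF p(1)] distinct_edge_mult[OF p(1)] by (simp add: walk_vec_def)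
  qed
  ultimately show ?thesis unfolding binary_polyhedron_def by blast
qed

section \<open>Induced cycles\<close>

text \<open>
  Going once around the cycle and then repeating its first edge makes every vertex of the cycle
  an interior vertex of the walk, so that the turns of this walk are exactly those of the cycle.
\<close>

lemma induced_cycle_closed_walk:
  assumes c: "induced_cycle V E c" "4 \<le> length c"
  shows "locally_induced E (c @ [c ! 0, c ! 1])"
proof -
  define n where "n = length c"
  let ?p = "c @ [c ! 0, c ! 1]"
  have n: "4 \<le> n" "distinct c" using c by (simp_all add: n_def induced_cycle_def)
  have adj: "{c ! i, c ! j} \<in> E \<longleftrightarrow> j = Suc i mod n \<or> i = Suc j mod n" if "i < n" "j < n" for i j
    using that c(1) by (simp add: n_def induced_cycle_def)
  have nth: "?p ! i = c ! (i mod n)" if i: "i < n + 2" for i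
  proof -
    consider "i < n" | "i = n" | "i = Suc n" using i by linarith
    then show ?thesis using n by cases (simp_all add: nth_append mod_Suc n_def)
  qed
  have edge: "{?p ! i, ?p ! Suc i} \<in> E" if "Suc i < n + 2" for i
    using that n nth[of i] nth[of "Suc i"] adj[of "i mod n" "Suc i mod n"] by (simp add: mod_Suc_eq)
  have turn: "turn E (?p ! Suc i) (?p ! i) (?p ! Suc (Suc i))" if i: "Suc (Suc i) < n + 2" for i
  proof -
    define k where "k = i mod n"
    define l where "l = Suc (Suc i) mod n"
    have "k < n" "l < n" using n by (simp_all add: k_def l_def)
    \<comment> \<open>The outer vertices of a turn are two apart on the cycle. From length 4 on they
      are neither equal nor consecutive; in a triangle they would be adjacent.\<close>
    have kl: "l = (if Suc (Suc k) < n then Suc (Suc k) else Suc (Suc k) - n)"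
    proof -
      have "l = (k + 2) mod n" using mod_add_left_eq[of i n 2] by (simp add: k_def l_def)
      then show ?thesis using \<open>k < n\<close> n by (simp add: mod_if)
    qed
    have "k \<noteq> l" using kl n \<open>k < n\<close> by (auto split: if_splits)
    then have "c ! k \<noteq> c ! l" using n \<open>k < n\<close> \<open>l < n\<close> by (simp add: nth_eq_iff_index_eq n_def)
    moreover have "{c ! k, c ! l} \<notin> E"
    proof -
      have "Suc k mod n = (if Suc k = n then 0 else Suc k)" "Suc l mod n = (if Suc l = n then 0 else Suc l)"
        using \<open>k < n\<close> \<open>l < n\<close> by simp_all
      then show ?thesis
        unfolding adj[OF \<open>k < n\<close> \<open>l < n\<close>] using kl n \<open>k < n\<close> by (auto split: if_splits)
    qed
    moreover have "?p ! i = c ! k" "?p ! Suc (Suc i) = c ! l" using nth i by (simp_all add: k_def l_def)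
    ultimately show ?thesis
      using edge[of i] edge[of "Suc i"] i unfolding turn_def by (simp add: insert_commute)
  qed
  have len: "length ?p = n + 2" by (simp add: n_def)
  show ?thesis
    unfolding locally_induced_def
  proof (intro conjI allI impI)
    show "e \<in> E" if "edge_mult ?p e \<noteq> 0" for e
    proof -
      obtain i where "Suc i < n + 2" "e = {?p ! i, ?p ! Suc i}"
        using \<open>edge_mult ?p e \<noteq> 0\<close> unfolding edge_mult_neq_0_iff len by blast
      then show ?thesis using edge by simp
    qed
    show "turn E w u v" if "turn_mult ?p w u v \<noteq> 0" for w u v
    proof -
      obtain i where i: "Suc (Suc i) < n + 2" "w = ?p ! Suc i"
        and "u = ?p ! i \<and> v = ?p ! Suc (Suc i) \<or> u = ?p ! Suc (Suc i) \<and> v = ?p ! i"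
        using \<open>turn_mult ?p w u v \<noteq> 0\<close> unfolding turn_mult_neq_0_iff len by blast
      then show ?thesis using turn[OF i(1)] turn_sym[OF turn[OF i(1)]] by (elim disjE conjE) simp_all
    qed
  qed
qed

text \<open>Compared with the cycle, the closed walk counts the edge \<open>{c ! 0, c ! 1}\<close>
  and its two ends once too often. This excess is exactly the end terms of the row identity and
  cancels in the degree identity, so both hold with equality for the cycle.\<close>

lemma induced_cycle_recession:
  fixes V :: "'v::finite set"
  assumes G: "fin_simple_graph V E" and c: "induced_cycle V E c" "4 \<le> length c"
  shows "transitions V E (vertex_mult c) (edge_mult (c @ [c ! 0])) (turn_mult (c @ [c ! 0, c ! 1]))"
proof -
  let ?p = "c @ [c ! 0, c ! 1]" and ?y = "edge_mult (c @ [c ! 0])"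
  have li: "locally_induced E ?p" by (rule induced_cycle_closed_walk[OF c])
  have cV: "set c \<subseteq> V" using c(1) by (simp add: induced_cycle_def)
  have pV: "set ?p \<subseteq> V" using cV c(2) by (auto intro!: nth_mem[THEN subsetD[OF cV]])
  have card: "edge_mult ?p e \<noteq> 0 \<Longrightarrow> card e = 2" for e
    using G li by (auto simp: locally_induced_def fin_simple_graph_def)
  have two: "2 \<le> length ?p" by simp
  have y: "edge_mult ?p e = ?y e + of_bool (e = {c ! 0, c ! 1})" for e by (rule edge_mult_snoc)
  have "distinct c" "0 < length c" "1 < length c"
    using c unfolding induced_cycle_def by (blast, linarith+)
  from nth_eq_iff_index_eq[OF this] have ne: "c ! 0 \<noteq> c ! 1" by simp
  \<comment> \<open>The walk starts and ends with the same edge in the same direction, so the two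
    end terms are the two orientations of \<open>{c ! 0, c ! 1}\<close>.\<close>
  have hd: "hd ?p = c ! 0" "hd (tl ?p) = c ! 1" "last ?p = c ! 1" "last (butlast ?p) = c ! 0"
    using c(2) by (cases c; cases "tl c"; simp add: butlast_append)+
  have row: "?y {w, u} = (\<Sum>v\<in>UNIV. turn_mult ?p w u v)" for w u
    using edge_mult_row[OF card two, of w u] y[of "{w, u}"] ne unfolding hd
    by (cases "w = c ! 0"; cases "w = c ! 1") (auto simp: doubleton_eq_iff)
  have deg: "(\<Sum>u\<in>UNIV. ?y {w, u})
      = vertex_mult c w + (\<Sum>u\<in>UNIV. \<Sum>v\<in>UNIV. turn_mult ?p w u v) / 2" for w
  proof -
    have "(\<Sum>u\<in>UNIV. edge_mult ?p {w, u}) = (\<Sum>u\<in>UNIV. ?y {w, u}) + (of_bool (w = c ! 0) + of_bool (w = c ! 1))"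
      by (simp only: y sum.distrib sum_edge_ind[OF ne])
    moreover have "vertex_mult ?p w = vertex_mult c w + (of_bool (w = c ! 0) + of_bool (w = c ! 1))"
      by (simp add: vertex_mult_def)
    ultimately show ?thesis using vertex_mult_eq[OF card two, of w] by linarith
  qed
  have T: "transitions V E (vertex_mult ?p) (edge_mult ?p) (turn_mult ?p)"
    by (rule transitions_walk[OF G li pV])
  have "?y e = 0" if "e \<notin> E" for e
  proof -
    have "edge_mult ?p e = 0" using li that by (auto simp: locally_induced_def)
    then show ?thesis using y[of e] edge_mult_nonneg[of "c @ [c ! 0]" e]
      by (simp add: add_nonneg_eq_0_iff)
  qed
  moreover have "vertex_mult c v = 0" if "v \<notin> V" for v
  proof -
    have "v \<notin> set c" using that cV by blast
    then show ?thesis by (simp add: vertex_mult_def)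
  qed
  moreover have "fractional_matching (turn E w) (\<lambda>u. ?y {w, u}) (turn_mult ?p w)" for w
    using T row unfolding transitions_def fractional_matching_def by (metis order_refl)
  ultimately show ?thesis
    using deg by (simp add: transitions_def edge_mult_nonneg)
qed

text \<open>The cycle has \<open>euler\<close> value 0, so adding any nonnegative multiple of it to
  a one-vertex walk stays in the polyhedron.\<close>

lemma bounded_imp_chordal:
  fixes V :: "'v::finite set"
  assumes G: "fin_simple_graph V E" and b: "bounded (polyhedron_P V E)"
  shows "chordal V E"
proof (rule ccontr)
  assume "\<not> chordal V E"
  then obtain c where c: "induced_cycle V E c" "4 \<le> length c" by (auto simp: chordal_def)
  define a where "a = c ! 0"
  have cV: "set c \<subseteq> V" using c(1) by (simp add: induced_cycle_def)
  have ac: "a \<in> set c" unfolding a_def by (rule nth_mem) (use c(2) in linarith)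
  let ?y = "edge_mult (c @ [a])" and ?p = "c @ [c ! 0, c ! 1]"
  have rec: "transitions V E (vertex_mult c) ?y (turn_mult ?p)"
    unfolding a_def by (rule induced_cycle_recession[OF G c])
  have "[a] \<in> induced_walks V E" using ac cV by (intro singleton_in_induced_walks) blast
  then have base: "walk_vec [a] \<in> polyhedron_P V E"
    and li: "locally_induced E [a]" "set [a] \<subseteq> V"
    using walk_vec_in_polyhedron_P[OF G] by (auto simp: induced_walks_def)
  define d :: "(real^'v) \<times> (real^'v set)" where "d = (\<chi> v. vertex_mult c v, \<chi> e. ?y e)"
  have "?y e \<noteq> 0 \<Longrightarrow> e \<in> E" for e using rec by (auto simp: transitions_def)
  \<comment> \<open>The list closed by its first vertex has as many steps as the cycle has
    vertices.\<close>
  from sum_edge_mult[OF finite this] sum_vertex_mult[OF finite cV]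
  have d0: "euler V E d = 0" by (simp add: euler_def d_def)
  have ray: "walk_vec [a] + t *\<^sub>R d \<in> polyhedron_P V E" if "0 \<le> t" for t
  proof -
    have "walk_vec [a] + t *\<^sub>R d \<in> cone_P V E"
      using transitions_combine[OF transitions_walk[OF G li] rec zero_le_one that]
      by (auto simp: walk_vec_def d_def cone_P_iff_transitions[OF G])
    moreover have "euler V E (walk_vec [a] + t *\<^sub>R d) = 1"
      using base d0 by (simp add: polyhedron_P_iff linear_add[OF linear_euler] linear_scale[OF linear_euler])
    ultimately show ?thesis by (simp add: polyhedron_P_iff)
  qed
  obtain B where B: "\<And>q. q \<in> polyhedron_P V E \<Longrightarrow> norm q \<le> B"
    using b by (auto simp: bounded_iff)
  have one: "1 \<le> vertex_mult c a"
    using ac count_list_0_iff[of c a] by (simp add: vertex_mult_def)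
  \<comment> \<open>The coordinate at \<open>a\<close> alone grows at least as fast as
    \<open>t\<close>.\<close>
  have "t \<le> B" if "0 \<le> t" for t
  proof -
    let ?q = "walk_vec [a] + t *\<^sub>R d"
    have "t * 1 \<le> t * vertex_mult c a" using one that by (rule mult_left_mono)
    then have "t \<le> fst ?q $ a" by (simp add: walk_vec_def d_def vertex_mult_def)
    also have "\<dots> \<le> norm (fst ?q)" using component_le_norm_cart[of "fst ?q" a] by linarith
    also have "\<dots> \<le> norm ?q" by (metis norm_fst_le prod.collapse)
    also have "\<dots> \<le> B" by (rule B[OF ray[OF that]])
    finally show ?thesis .
  qed
  from this[of "\<bar>B\<bar> + 1"] show False by simp
qed

theorem theorem2p12:
  fixes V :: "'v::finite set" and E :: "'v set set"
  assumes "fin_simple_graph V E"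
  shows "chordal V E \<longleftrightarrow> binary_polyhedron (polyhedron_P V E)"
  using chordal_imp_binary[OF assms] bounded_imp_chordal[OF assms] polytope_imp_bounded
  unfolding binary_polyhedron_def by blast

end
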